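(* Up to isomorphism, there are exactly $6$ finite groups among the groups generated by $3$-state invertible automata over a $2$-letter alphabet: the trivial group $\{1\}$ (generated by $\mathcal A_{1}$), $C_2$ (generated by $\mathcal A_{1090}$), $C_2\times C_2$ (generated by $\mathcal A_{730}$), $D_4$ (generated by $\mathcal A_{847}$), $C_2\times C_2\times C_2$ (generated by $\mathcal A_{802}$) and $D_4\times C_2$ (generated by $\mathcal A_{748}$).
   Context: Let $X=\{0,1\}$ and let $X^*$ be the set of finite words over $X$, viewed as the rooted binary tree. An invertible automaton $A$ with $3$ states $1,2,3$ over $X$ is given by a system $q=\sigma^{a_{q1}}(a_{q2},a_{q3})$, $q=1,2,3$, where $a_{q1}\in\{0,1\}$, $a_{q2},a_{q3}\in\{1,2,3\}$ and $\sigma$ is the transposition $(01)$ of $X$. Each state $q$ defines an automorphism of the tree $X^*$, recursively by $q(\emptyset)=\emptyset$, $q(0w)=\sigma^{a_{q1}}(0)\,a_{q2}(w)$ and $q(1w)=\sigma^{a_{q1}}(1)\,a_{q3}(w)$ for all $w\in X^*$. The automaton group $G(A)$ is the subgroup of $\mathrm{Aut}(X^* )$ generated by the three states. The automaton is assigned the number $$(a_{12}-1)+3(a_{13}-1)+9(a_{22}-1)+27(a_{23}-1)+81(a_{32}-1)+243(a_{33}-1)+729(a_{11}+2a_{21}+4a_{31})+1,$$ and $\mathcal A_n$ denotes the automaton with number $n$, $1\le n\le 5832$. $C_2$ is the cyclic group of order $2$ and $D_4$ is the dihedral group of order $8$. *)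

theory Defs
  imports
    "HOL-Algebra.Algebra"
    "HOL-Combinatorics.Transposition"
    "HOL-Library.Z2"
begin

text \<open>The alphabet \<open>X = {0, 1}\<close> is the type \<^typ>\<open>bit\<close>, and words over \<open>X\<close> are lists.
  An automaton \<open>a\<close> is its \<open>3 \<times> 3\<close> table of parameters, extensional so that distinct
  automata differ in one of the nine entries \<open>a q j\<close>.\<close>

definition automata :: "(nat \<Rightarrow> nat \<Rightarrow> nat) set" where
  "automata = (\<Pi>\<^sub>E q\<in>{1, 2, 3}. \<Pi>\<^sub>E j\<in>{1, 2, 3}. if j = 1 then {0, 1} else {1, 2, 3})"

definition \<sigma> :: "bit \<Rightarrow> bit" where
  "\<sigma> = transpose 0 1"

fun state_map :: "(nat \<Rightarrow> nat \<Rightarrow> nat) \<Rightarrow> nat \<Rightarrow> bit list \<Rightarrow> bit list" where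
  "state_map a q [] = []"
| "state_map a q (x # w) =
     (\<sigma> ^^ a q 1) x # state_map a (if x = 0 then a q 2 else a q 3) w"

definition tree_adjacent :: "bit list \<Rightarrow> bit list \<Rightarrow> bool" where
  "tree_adjacent u v \<longleftrightarrow> (\<exists>x. v = u @ [x] \<or> u = v @ [x])"

definition tree_aut :: "(bit list \<Rightarrow> bit list) monoid" where
  "tree_aut =
     \<lparr>carrier = {f. bij f \<and> f [] = [] \<and>
                    (\<forall>u v. tree_adjacent (f u) (f v) \<longleftrightarrow> tree_adjacent u v)},
      monoid.mult = (\<circ>), one = id\<rparr>"

definition automaton_group :: "(nat \<Rightarrow> nat \<Rightarrow> nat) \<Rightarrow> (bit list \<Rightarrow> bit list) monoid" where
  "automaton_group a = subgroup_generated tree_aut (state_map a ` {1, 2, 3})"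

text \<open>On \<^const>\<open>automata\<close> the natural-number subtractions below are never truncated.\<close>

definition automaton_number :: "(nat \<Rightarrow> nat \<Rightarrow> nat) \<Rightarrow> nat" where
  "automaton_number a =
     (a 1 2 - 1) + 3 * (a 1 3 - 1) + 9 * (a 2 2 - 1) + 27 * (a 2 3 - 1)
     + 81 * (a 3 2 - 1) + 243 * (a 3 3 - 1) + 729 * (a 1 1 + 2 * a 2 1 + 4 * a 3 1) + 1"

definition \<A> :: "nat \<Rightarrow> nat \<Rightarrow> nat \<Rightarrow> nat" where
  "\<A> n = (THE a. a \<in> automata \<and> automaton_number a = n)"

text \<open>The dihedral group of order \<open>2 * n\<close>, where \<open>(i, j)\<close> stands for \<open>r^i s^j\<close> with a
  rotation \<open>r\<close> of order \<open>n\<close> and a reflection \<open>s\<close>, so that \<open>s r^k = r^(-k) s\<close>.\<close>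

definition dihedral_group :: "nat \<Rightarrow> (int \<times> nat) monoid" where
  "dihedral_group n =
     \<lparr>carrier = {0..<int n} \<times> {0..<2},
      monoid.mult = (\<lambda>(i, j) (k, l). ((i + (- 1) ^ j * k) mod int n, (j + l) mod 2)),
      one = (0, 0)\<rparr>"


text \<open>\<^const>\<open>tree_aut\<close> is a group containing the state maps, so that
  \<^const>\<open>subgroup_generated\<close> discards no generator, and \<^const>\<open>\<A>\<close> is well defined.\<close>

lemma group_tree_aut: "group tree_aut"
proof (rule groupI)
  fix f assume f: "f \<in> carrier tree_aut"
  let ?g = "inv_into UNIV f"
  from f have b: "bij f" and e: "f [] = []"
    and adj: "\<And>u v. tree_adjacent (f u) (f v) \<longleftrightarrow> tree_adjacent u v"
    by (auto simp: tree_aut_def)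
  have "tree_adjacent (?g u) (?g v) \<longleftrightarrow> tree_adjacent u v" for u v
    using adj[of "?g u" "?g v"] b by (simp add: bij_is_surj surj_f_inv_f)
  moreover have "?g [] = []"
    using b e by (metis bij_is_inj inv_f_f)
  ultimately have "?g \<in> carrier tree_aut"
    using b by (simp add: tree_aut_def bij_imp_bij_inv)
  moreover have "?g \<otimes>\<^bsub>tree_aut\<^esub> f = \<one>\<^bsub>tree_aut\<^esub>"
    using b by (simp add: tree_aut_def bij_is_inj)
  ultimately show "\<exists>g\<in>carrier tree_aut. g \<otimes>\<^bsub>tree_aut\<^esub> f = \<one>\<^bsub>tree_aut\<^esub>"
    by blast
qed (auto simp: tree_aut_def bij_comp comp_assoc)

lemma automata_entries:
  assumes "a \<in> automata" "q \<in> {1, 2, 3}"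
  shows "a q 1 \<in> {0, 1}" "a q 2 \<in> {1, 2, 3}" "a q 3 \<in> {1, 2, 3}"
proof -
  have *: "a q \<in> (\<Pi>\<^sub>E j\<in>{1, 2, 3}. if j = 1 then {0, 1} else {1, 2, 3})"
    using assms unfolding automata_def by (rule PiE_mem)
  show "a q 1 \<in> {0, 1}" "a q 2 \<in> {1, 2, 3}" "a q 3 \<in> {1, 2, 3}"
    using PiE_mem[OF *, of 1] PiE_mem[OF *, of 2] PiE_mem[OF *, of 3] by simp_all
qed

lemma bij_sigma_pow: "bij (\<sigma> ^^ k)"
  by (simp add: \<sigma>_def bij_betw_funpow)

lemma length_state_map [simp]: "length (state_map a q w) = length w"
  by (induction w arbitrary: q) auto

lemma inj_state_map: "inj (state_map a q)"
proof (rule injI)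
  fix u v :: "bit list"
  assume "state_map a q u = state_map a q v"
  then show "u = v"
  proof (induction u arbitrary: q v)
    case Nil
    then show ?case by (cases v) auto
  next
    case (Cons x u)
    then obtain y v' where v: "v = y # v'" by (cases v) auto
    have "x = y"
      using Cons.prems bij_is_inj[OF bij_sigma_pow] v by (auto dest: injD)
    then show ?case using Cons v by auto
  qed
qed

lemma surj_state_map: "\<exists>u. state_map a q u = v"
proof (induction v arbitrary: q)
  case Nil
  show ?case by (rule exI[of _ "[]"]) simp
next
  case (Cons y v)
  obtain x where x: "(\<sigma> ^^ a q 1) x = y"
    using bij_is_surj[OF bij_sigma_pow] by (metis surjD)
  obtain u where "state_map a (if x = 0 then a q 2 else a q 3) u = v"
    using Cons by blast
  then have "state_map a q (x # u) = y # v" using x by simp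
  then show ?case ..
qed

lemma state_map_append: "\<exists>y. state_map a q (u @ [x]) = state_map a q u @ [y]"
  by (induction u arbitrary: q) auto

lemma state_map_extension:
  "(\<exists>x. state_map a q v = state_map a q u @ [x]) \<longleftrightarrow> (\<exists>x. v = u @ [x])"
proof
  assume "\<exists>x. state_map a q v = state_map a q u @ [x]"
  then obtain x where x: "state_map a q v = state_map a q u @ [x]" ..
  then have "length v = Suc (length u)"
    by (metis length_append_singleton length_state_map)
  then obtain w y where v: "v = w @ [y]" by (metis length_Suc_conv_rev)
  then have "state_map a q w = state_map a q u"
    using x state_map_append[of a q w y] by auto
  then show "\<exists>x. v = u @ [x]" using v inj_state_map by (metis injD)
qed (use state_map_append in blast)

lemma state_map_in_tree_aut: "state_map a q \<in> carrier tree_aut"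
proof -
  have "tree_adjacent (state_map a q u) (state_map a q v) \<longleftrightarrow> tree_adjacent u v" for u v
    unfolding tree_adjacent_def ex_disj_distrib state_map_extension ..
  moreover have "bij (state_map a q)"
    using inj_state_map surj_state_map by (metis bijI surjI)
  ultimately show ?thesis by (simp add: tree_aut_def)
qed

lemma automata_eqI:
  assumes "a \<in> automata" "b \<in> automata"
    and "\<And>q j. q \<in> {1, 2, 3} \<Longrightarrow> j \<in> {1, 2, 3} \<Longrightarrow> a q j = b q j"
  shows "a = b"
proof (rule PiE_ext)
  show "a \<in> (\<Pi>\<^sub>E q\<in>{1, 2, 3}. \<Pi>\<^sub>E j\<in>{1, 2, 3}. if j = 1 then {0, 1} else {1, 2, 3})"
    "b \<in> (\<Pi>\<^sub>E q\<in>{1, 2, 3}. \<Pi>\<^sub>E j\<in>{1, 2, 3}. if j = 1 then {0, 1} else {1, 2, 3})"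
    using assms unfolding automata_def by blast+
  fix q :: nat
  assume q: "q \<in> {1, 2, 3}"
  show "a q = b q"
  proof (rule PiE_ext)
    show "a q \<in> (\<Pi>\<^sub>E j\<in>{1, 2, 3}. if j = 1 then {0, 1} else {1, 2, 3})"
      "b q \<in> (\<Pi>\<^sub>E j\<in>{1, 2, 3}. if j = 1 then {0, 1} else {1, 2, 3})"
      using assms(1,2) q unfolding automata_def by (blast intro: PiE_mem)+
  qed (use assms(3) q in blast)
qed

lemma digit_cancel:
  fixes x y x' y' m :: nat
  assumes "x + m * y = x' + m * y'" "x < m" "x' < m"
  shows "x = x'" "y = y'"
proof -
  show "x = x'" using assms by (metis mod_less mod_mult_self2)
  then show "y = y'" using assms by simp
qed

lemma automaton_number_horner:
  "automaton_number a = Suc ((a 1 2 - 1) + 3 * ((a 1 3 - 1) + 3 * ((a 2 2 - 1)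
     + 3 * ((a 2 3 - 1) + 3 * ((a 3 2 - 1) + 3 * ((a 3 3 - 1)
     + 3 * (a 1 1 + 2 * (a 2 1 + 2 * a 3 1))))))))"
  by (simp add: automaton_number_def algebra_simps)

lemma automaton_number_inj:
  assumes a: "a \<in> automata" and b: "b \<in> automata"
    and n: "automaton_number a = automaton_number b"
  shows "a = b"
proof (rule automata_eqI[OF a b])
  have bounds: "c q 1 < 2" "c q 2 - 1 < 3" "c q 3 - 1 < 3" "c q 2 \<ge> 1" "c q 3 \<ge> 1"
    if "c \<in> automata" "q \<in> {1, 2, 3}" for c q
    using automata_entries[OF that] by auto
  have 1: "(1::nat) \<in> {1, 2, 3}" and 2: "(2::nat) \<in> {1, 2, 3}" and 3: "(3::nat) \<in> {1, 2, 3}"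
    by simp_all
  note A1 = bounds[OF a 1] and A2 = bounds[OF a 2] and A3 = bounds[OF a 3]
  note B1 = bounds[OF b 1] and B2 = bounds[OF b 2] and B3 = bounds[OF b 3]
  note d0 = n[unfolded automaton_number_horner nat.inject]
  note d1 = digit_cancel[OF d0 A1(2) B1(2)]
  note d2 = digit_cancel[OF d1(2) A1(3) B1(3)]
  note d3 = digit_cancel[OF d2(2) A2(2) B2(2)]
  note d4 = digit_cancel[OF d3(2) A2(3) B2(3)]
  note d5 = digit_cancel[OF d4(2) A3(2) B3(2)]
  note d6 = digit_cancel[OF d5(2) A3(3) B3(3)]
  note d7 = digit_cancel[OF d6(2) A1(1) B1(1)]
  note d8 = digit_cancel[OF d7(2) A2(1) B2(1)]
  have eqs: "a 1 2 = b 1 2" "a 1 3 = b 1 3" "a 2 2 = b 2 2" "a 2 3 = b 2 3"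
    "a 3 2 = b 3 2" "a 3 3 = b 3 3"
    using d1(1) d2(1) d3(1) d4(1) d5(1) d6(1) A1(4,5) A2(4,5) A3(4,5) B1(4,5) B2(4,5) B3(4,5)
    by (metis eq_diff_iff)+
  fix q j :: nat
  assume "q \<in> {1, 2, 3}" "j \<in> {1, 2, 3}"
  then show "a q j = b q j"
    using eqs d7(1) d8 by (elim insertE emptyE) simp_all
qed

lemma automaton_number_surj:
  assumes "1 \<le> n" "n \<le> 5832"
  shows "\<exists>a\<in>automata. automaton_number a = n"
proof -
  define m where "m = n - 1"
  define c where "c k = m div 3 ^ k mod 3" for k :: nat
  define d where "d k = c k + 1" for k
  define e where "e k = m div 729 div 2 ^ k mod 2" for k :: nat
  define a where "a = (\<lambda>q\<in>{1, 2, 3}. \<lambda>j\<in>{1, 2, 3}.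
    if j = 1 then e (q - 1) else d (2 * (q - 1) + (j - 2)))"
  have d: "d k \<in> {1, 2, 3}" and e: "e k \<in> {0, 1}" for k
    unfolding d_def c_def e_def by auto
  have "a \<in> automata"
    unfolding a_def automata_def restrict_PiE_iff using d e by simp
  moreover have "automaton_number a = n"
  proof -
    have "m div 729 < 8" using assms by (simp add: m_def less_mult_imp_div_less)
    then have "m div 729 \<in> {0, 1, 2, 3, 4, 5, 6, 7}" by auto
    then have top: "e 0 + 2 * (e 1 + 2 * e 2) = m div 729"
      unfolding e_def by auto
    have step: "m div 3 ^ k = c k + 3 * (m div 3 ^ Suc k)" for k
      unfolding c_def power_Suc2 div_mult2_eq by simp
    have entries: "a 1 1 = e 0" "a 2 1 = e 1" "a 3 1 = e 2" "a 1 2 = d 0" "a 1 3 = d 1"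
      "a 2 2 = d 2" "a 2 3 = d 3" "a 3 2 = d 4" "a 3 3 = d 5"
      by (simp_all add: a_def)
    have nested: "x0 = c 0 + 3 * (c 1 + 3 * (c 2 + 3 * (c 3 + 3 * (c 4 + 3 * (c 5 + 3 * x6)))))"
      if "x0 = c 0 + 3 * x1" "x1 = c 1 + 3 * x2" "x2 = c 2 + 3 * x3" "x3 = c 3 + 3 * x4"
        "x4 = c 4 + 3 * x5" "x5 = c 5 + 3 * x6" for x0 x1 x2 x3 x4 x5 x6
      using that by simp
    have "m = c 0 + 3 * (m div 3)" "m div 3 = c 1 + 3 * (m div 9)"
      "m div 9 = c 2 + 3 * (m div 27)" "m div 27 = c 3 + 3 * (m div 81)"
      "m div 81 = c 4 + 3 * (m div 243)" "m div 243 = c 5 + 3 * (m div 729)"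
      using step[of 0] step[of 1] step[of 2] step[of 3] step[of 4] step[of 5] by simp_all
    then have "m = c 0 + 3 * (c 1 + 3 * (c 2 + 3 * (c 3 + 3 * (c 4 + 3 * (c 5
      + 3 * (m div 729))))))"
      by (rule nested)
    then have "automaton_number a = Suc m"
      unfolding automaton_number_horner entries top d_def add_diff_cancel_right' by (rule arg_cong[OF sym])
    then show ?thesis using assms(1) by (simp add: m_def)
  qed
  ultimately show ?thesis by blast
qed

lemma \<A>_properties:
  assumes "1 \<le> n" "n \<le> 5832"
  shows "\<A> n \<in> automata" "automaton_number (\<A> n) = n"
proof -
  have "\<exists>!a. a \<in> automata \<and> automaton_number a = n"
    using automaton_number_surj[OF assms] automaton_number_inj by metis
  from theI'[OF this] show "\<A> n \<in> automata" "automaton_number (\<A> n) = n"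
    unfolding \<A>_def by blast+
qed

end

(* Proof idea. The group of a finite automaton is studied through words in its states and their
   inverses. Up to a permutation of the states the active ones come first. If all states are
   inactive or all are active, the group is trivial or has order 2. For the remaining 1458 automata
   one of three kinds of certificates, found by a search, is checked by evaluation:
   - an element w whose number of flips is odd on every level; as w^2 restricts to an element of
     the same kind on a subtree, w^(2^n) is never trivial, and since odd powers of w are again of
     this kind, w has infinite order;
   - a subgroup K moving a vertex v such that the sections at v of the elements of K fixing v
     include all of K; if K were finite, the stabilizer of v would be at once smaller than K and
     at least as large as K;
   - generators r, s, c that satisfy the relations of a dihedral group times a cyclic group, whose
     normal forms act nontrivially.
   Triviality of a word is verified by a finite set of words that fix the first level and is closed
   under sections, nontriviality by a vertex that is moved. *)
theory Submission
  imports Defs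
begin

subsection \<open>Words acting on the binary tree\<close>

datatype state = A | B | C

text \<open>\<open>P q\<close> stands for the state \<open>q\<close> and \<open>N q\<close> for its
  inverse, so that lists of letters are group words.\<close>

datatype letter = P state | N state

datatype 'a triple = Triple 'a 'a 'a

text \<open>\<open>Row f l r\<close> is a state with sections \<open>l\<close> and \<open>r\<close>
  at the letters 0 and 1, active if \<open>f\<close>. Datatypes replace the extensional functions so
  that the checks below can be evaluated by rewriting.\<close>

datatype row = Row bool state state

type_synonym word = "letter list"
type_synonym table = "row triple"

fun entry :: "'a triple \<Rightarrow> state \<Rightarrow> 'a" where
  "entry (Triple x y z) A = x"
| "entry (Triple x y z) B = y"
| "entry (Triple x y z) C = z"

fun active :: "row \<Rightarrow> bool" where
  "active (Row f l r) = f"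

fun target :: "row \<Rightarrow> bool \<Rightarrow> state" where
  "target (Row f l r) False = l"
| "target (Row f l r) True = r"

fun flips :: "table \<Rightarrow> letter \<Rightarrow> bool" where
  "flips t (P q) = active (entry t q)"
| "flips t (N q) = active (entry t q)"

text \<open>The section of an inverse at \<open>b\<close> is the inverse of the section at the
  preimage of \<open>b\<close>; hence the flip of \<open>b\<close> in the second clause.\<close>

fun child :: "table \<Rightarrow> letter \<Rightarrow> bool \<Rightarrow> letter" where
  "child t (P q) b = P (target (entry t q) b)"
| "child t (N q) b = N (target (entry t q) (b \<noteq> active (entry t q)))"

fun run :: "table \<Rightarrow> letter \<Rightarrow> bool list \<Rightarrow> bool list" where
  "run t l [] = []"
| "run t l (b # v) = (b \<noteq> flips t l) # run t (child t l b) v"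

text \<open>Words act from left to right: their first letter is applied first.\<close>

definition act :: "table \<Rightarrow> word \<Rightarrow> bool list \<Rightarrow> bool list" where
  "act t w = fold (run t) w"

fun opposite :: "letter \<Rightarrow> letter" where
  "opposite (P q) = N q"
| "opposite (N q) = P q"

definition inverse_word :: "word \<Rightarrow> word" where
  "inverse_word w = rev (map opposite w)"

text \<open>Multiplication by one letter in the free group: a reduced word is taken to a reduced
  word.\<close>

fun push :: "letter \<Rightarrow> word \<Rightarrow> word" where
  "push l [] = [l]"
| "push l (m # w) = (if m = opposite l then w else l # m # w)"

fun root_image :: "table \<Rightarrow> word \<Rightarrow> bool \<Rightarrow> bool" where
  "root_image t [] b = b"
| "root_image t (l # w) b = root_image t w (b \<noteq> flips t l)"

text \<open>Sections are freely reduced, which keeps the sets of words met by \<open>closes\<close> small.\<close>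

fun section_at :: "table \<Rightarrow> word \<Rightarrow> bool \<Rightarrow> word" where
  "section_at t [] b = []"
| "section_at t (l # w) b = push (child t l b) (section_at t w (b \<noteq> flips t l))"

fun vertex_image :: "table \<Rightarrow> word \<Rightarrow> bool list \<Rightarrow> bool list" where
  "vertex_image t w [] = []"
| "vertex_image t w (b # v) = root_image t w b # vertex_image t (section_at t w b) v"

fun section_along :: "table \<Rightarrow> word \<Rightarrow> bool list \<Rightarrow> word" where
  "section_along t w [] = w"
| "section_along t w (b # v) = section_along t (section_at t w b) v"

text \<open>A set of words that fix the first level and is closed under sections acts trivially;
  the search collects such a set in \<open>seen\<close>.\<close>

fun closes :: "table \<Rightarrow> nat \<Rightarrow> word list \<Rightarrow> word list \<Rightarrow> bool" where
  "closes t n seen [] = True"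
| "closes t 0 seen (w # ws) = False"
| "closes t (Suc n) seen (w # ws) =
     (if w = [] \<or> w \<in> set seen then closes t n seen ws
      else if root_image t w False then False
      else closes t n (w # seen) (section_at t w False # section_at t w True # ws))"

text \<open>The bound 128 is fuel. When it runs out, \<open>closes\<close> answers
  \<open>False\<close>, so the bound can cost certificates but never soundness.\<close>

definition trivial :: "table \<Rightarrow> word \<Rightarrow> bool" where
  "trivial t w = closes t 128 [] [foldr push w []]"

fun nontrivial :: "table \<Rightarrow> nat \<Rightarrow> word \<Rightarrow> bool" where
  "nontrivial t 0 w = False"
| "nontrivial t (Suc n) w = (if root_image t w False then True
     else if nontrivial t n (section_at t w False) then True
     else nontrivial t n (section_at t w True))"

text \<open>Conditionals instead of conjunctions and disjunctions, since evaluation by rewriting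
  would compute both arguments of the latter.\<close>

fun every :: "('a \<Rightarrow> bool) \<Rightarrow> 'a list \<Rightarrow> bool" where
  "every f [] = True"
| "every f (x # xs) = (if f x then every f xs else False)"

fun any :: "('a \<Rightarrow> bool) \<Rightarrow> 'a list \<Rightarrow> bool" where
  "any f [] = False"
| "any f (x # xs) = (if f x then True else any f xs)"

definition states :: "state list" where
  "states = [A, B, C]"

subsection \<open>Certificates\<close>

text \<open>Modulo 2, the numbers of occurrences of the states in a word \<open>w\<close> determine whether \<open>w\<close>
  flips the root, and also the corresponding numbers for \<open>w\<^sup>2\<close> restricted to a subtree if it does.
  A set of parity vectors that flip and is closed under this step certifies infinite order.\<close>

fun xor3 :: "bool triple \<Rightarrow> bool triple \<Rightarrow> bool triple" where
  "xor3 (Triple a b c) (Triple x y z) = Triple (a \<noteq> x) (b \<noteq> y) (c \<noteq> z)"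

definition unit3 :: "state \<Rightarrow> bool triple" where
  "unit3 q = Triple (q = A) (q = B) (q = C)"

definition scale3 :: "bool \<Rightarrow> bool triple \<Rightarrow> bool triple" where
  "scale3 e c = (if e then c else Triple False False False)"

definition odd_flips :: "table \<Rightarrow> bool triple \<Rightarrow> bool" where
  "odd_flips t c = (((entry c A \<and> active (entry t A)) \<noteq> (entry c B \<and> active (entry t B)))
     \<noteq> (entry c C \<and> active (entry t C)))"

text \<open>A letter contributes one section to each child. Modulo 2 their sum does not depend on
  which child receives which, nor on whether the state or its inverse occurs.\<close>

definition below :: "row \<Rightarrow> bool triple" where
  "below r = xor3 (unit3 (target r False)) (unit3 (target r True))"

definition next_class :: "table \<Rightarrow> bool triple \<Rightarrow> bool triple" where
  "next_class t c = xor3 (scale3 (entry c A) (below (entry t A)))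
     (xor3 (scale3 (entry c B) (below (entry t B))) (scale3 (entry c C) (below (entry t C))))"

definition stays_odd :: "table \<Rightarrow> bool triple list \<Rightarrow> bool triple \<Rightarrow> bool" where
  "stays_odd t cs c \<longleftrightarrow> (if odd_flips t c then next_class t c \<in> set cs else False)"

definition odd_certificate :: "table \<Rightarrow> bool triple list \<Rightarrow> bool" where
  "odd_certificate t cs = every (stays_odd t cs) cs"

text \<open>In a certificate \<open>(s, v, u)\<close>, the words \<open>s\<close> generate a group that moves the vertex \<open>v\<close>, and
  the words \<open>u\<close> in these generators fix \<open>v\<close> and have the generators as sections there.\<close>

fun letter_subst :: "word triple \<Rightarrow> letter \<Rightarrow> word" where
  "letter_subst s (P q) = entry s q"
| "letter_subst s (N q) = inverse_word (entry s q)"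

definition subst :: "word triple \<Rightarrow> word \<Rightarrow> word" where
  "subst s w = concat (map (letter_subst s) w)"

definition moves :: "table \<Rightarrow> word triple \<Rightarrow> bool list \<Rightarrow> state \<Rightarrow> bool" where
  "moves t s v q \<longleftrightarrow> vertex_image t (entry s q) v \<noteq> v"

definition reproduces_word :: "table \<Rightarrow> bool list \<Rightarrow> word \<Rightarrow> word \<Rightarrow> bool" where
  "reproduces_word t v g h \<longleftrightarrow>
     (if vertex_image t h v = v then trivial t (section_along t h v @ inverse_word g) else False)"

definition reproduces ::
    "table \<Rightarrow> word triple \<Rightarrow> bool list \<Rightarrow> word triple \<Rightarrow> state \<Rightarrow> bool" where
  "reproduces t s v u q = reproduces_word t v (entry s q) (subst s (entry u q))"

fun self_similar_certificate ::
    "table \<Rightarrow> word triple \<times> bool list \<times> word triple \<Rightarrow> bool" where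
  "self_similar_certificate t (s, v, u) \<longleftrightarrow>
     (if any (moves t s v) states then every (reproduces t s v u) states else False)"

text \<open>In a certificate \<open>(n, k, r, s, c, e)\<close>, the words \<open>r\<close> and \<open>s\<close> play the rotation and the
  reflection of a dihedral group of order \<open>2 * n\<close>, the word \<open>c\<close> is central of order \<open>k\<close>, and \<open>e\<close>
  lists the exponents that express the states.\<close>

definition word_power :: "word \<Rightarrow> nat \<Rightarrow> word" where
  "word_power w n = concat (replicate n w)"

text \<open>As words act from left to right, this word is the map
  \<open>r^i s^j c^l\<close>.\<close>

fun normal_word :: "word \<Rightarrow> word \<Rightarrow> word \<Rightarrow> nat \<times> nat \<times> nat \<Rightarrow> word" where
  "normal_word r s c (i, j, l) = word_power c l @ word_power s j @ word_power r i"

definition generated ::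
    "table \<Rightarrow> word \<Rightarrow> word \<Rightarrow> word \<Rightarrow> (nat \<times> nat \<times> nat) triple \<Rightarrow> state \<Rightarrow> bool" where
  "generated t r s c e q = trivial t (normal_word r s c (entry e q) @ [N q])"

definition nonidentity ::
    "table \<Rightarrow> word \<Rightarrow> word \<Rightarrow> word \<Rightarrow> nat \<times> nat \<times> nat \<Rightarrow> bool" where
  "nonidentity t r s c x = nontrivial t 4 (normal_word r s c x)"

text \<open>The exponents \<open>(0, 0, 0)\<close> of the identity come first, so that the tail
  lists exactly the normal forms that have to act nontrivially.\<close>

definition exponents :: "nat \<Rightarrow> nat \<Rightarrow> (nat \<times> nat \<times> nat) list" where
  "exponents n k = List.product [0..<n] (List.product [0..<2] [0..<k])"

fun finite_certificate ::
    "table \<Rightarrow> nat \<times> nat \<times> word \<times> word \<times> word \<times> (nat \<times> nat \<times> nat) triple \<Rightarrow> bool" where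
  "finite_certificate t (n, k, r, s, c, e) \<longleftrightarrow>
     (if every (generated t r s c e) states
      then if every (trivial t) [word_power s 2, word_power r n, word_power c k, r @ s @ r @ s,
        c @ r @ inverse_word c @ inverse_word r, c @ s @ inverse_word c @ inverse_word s]
      then every (nonidentity t r s c) (tl (exponents n k)) else False else False)"

section \<open>Candidate certificates\<close>

definition odd_certificate_list :: "bool triple list list" where
  "odd_certificate_list = [[Triple True False True], [Triple True True False], [Triple False True True],
     [Triple True False True, Triple True True False],
     [Triple False True True, Triple True False True]]"

text \<open>An empty \<open>r\<close> or \<open>c\<close> goes with a trivial factor:
  \<open>n = 1\<close> leaves only the reflection, \<open>k = 1\<close> no central part.\<close>

definition finite_certificate_list ::
    "(nat \<times> nat \<times> word \<times> word \<times> word \<times> (nat \<times> nat \<times> nat) triple) list" where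
  "finite_certificate_list = [
    (1, 1, [], [P A], [], Triple (0, 1, 0) (0, 0, 0) (0, 0, 0)),
    (1, 2, [], [P A], [P C], Triple (0, 1, 0) (0, 1, 0) (0, 0, 1)),
    (1, 1, [], [P A], [], Triple (0, 1, 0) (0, 1, 0) (0, 0, 0)),
    (2, 2, [P A], [P B], [P C], Triple (1, 0, 0) (0, 1, 0) (0, 0, 1)),
    (1, 2, [], [P A], [P B], Triple (0, 1, 0) (0, 0, 1) (0, 0, 0)),
    (4, 1, [P A, P B], [P A], [], Triple (0, 1, 0) (1, 1, 0) (0, 0, 0)),
    (4, 1, [P A, P C], [P A], [], Triple (0, 1, 0) (0, 0, 0) (1, 1, 0)),
    (1, 2, [], [P B], [P A], Triple (0, 0, 1) (0, 1, 0) (0, 1, 0)),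
    (1, 2, [], [P C], [P B], Triple (0, 1, 1) (0, 0, 1) (0, 1, 0)),
    (4, 1, [P B], [P A], [], Triple (0, 1, 0) (1, 0, 0) (0, 0, 0)),
    (4, 1, [P A], [P B], [], Triple (1, 0, 0) (0, 1, 0) (0, 0, 0)),
    (4, 2, [P B], [P A], [P C], Triple (0, 1, 0) (1, 0, 0) (0, 0, 1)),
    (4, 2, [P A], [P B], [P C], Triple (1, 0, 0) (0, 1, 0) (0, 0, 1)),
    (4, 2, [P C, P A], [P A], [P B], Triple (0, 1, 0) (0, 0, 1) (3, 1, 0)),
    (4, 2, [P B, P A], [P B], [P C], Triple (1, 1, 0) (0, 1, 0) (0, 0, 1)),
    (1, 2, [], [P A], [P C], Triple (0, 1, 0) (0, 0, 0) (0, 0, 1))]"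

text \<open>Subgroups with fewer than three generators are padded with the empty word. In the third
  component \<open>P A\<close>, \<open>P B\<close> and \<open>P C\<close> name the generators in the
  first component, not the states.\<close>

definition self_similar_certificate_list :: "(word triple \<times> bool list \<times> word triple) list" where
  "self_similar_certificate_list = [
    (Triple [P A] [P C] [], [True], Triple [P B] [P A, P A, N B] []),
    (Triple [P A] [P C] [], [True], Triple [P B] [N A, P B, P A] []),
    (Triple [P A] [P C] [], [False], Triple [P B] [P A, P A, N B] []),
    (Triple [P A] [P C] [], [True], Triple [N A, P B, P A] [P B] []),
    (Triple [N C, P A] [] [], [False, False], Triple [P A, P A] [] []),
    (Triple [N B, P A] [] [], [True, False, True], Triple [P A, P A, P A, P A] [] []),
    (Triple [N B, P A] [] [], [True, False], Triple [P A, P A] [] []),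
    (Triple [N B, P A] [] [], [False, False, False], Triple [P A, P A, P A, P A] [] []),
    (Triple [N B, P A] [] [], [True, False], Triple [N A, N A] [] []),
    (Triple [N B, P A] [] [], [False, True], Triple [N A, N A] [] []),
    (Triple [N C, P A] [] [], [True, True, True, True], Triple [N A, N A, N A, N A] [] []),
    (Triple [N C, P A] [] [], [True, False], Triple [P A, P A] [] []),
    (Triple [N B, P A] [] [], [True, False, True], Triple [N A, N A, N A, N A] [] []),
    (Triple [P B] [P C] [], [False], Triple [P B] [P A, P A, N B] []),
    (Triple [P B] [P C] [], [False], Triple [N A, P B, P A] [P B] []),
    (Triple [P B] [P C] [], [True], Triple [P B] [P A, P A, N B] []),
    (Triple [P B] [P C] [], [True], Triple [N A, P B, P A] [P B] []),
    (Triple [P A] [P B] [], [True], Triple [P B] [N A, P B, P A] []),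
    (Triple [P A] [P B] [], [True], Triple [P A, P A, N B] [P B] []),
    (Triple [P A] [P B] [], [False], Triple [P A, P A, N B] [P B] []),
    (Triple [N C, P B] [] [], [True, False], Triple [P A, P A] [] []),
    (Triple [P A] [P B] [], [False], Triple [P B] [N A, P B, P A] []),
    (Triple [P A] [P C] [], [False], Triple [N A, P B, P A] [P B] []),
    (Triple [N C, P B] [] [], [True, False, True], Triple [P A, P A] [] []),
    (Triple [N C, P B] [] [], [False, True, False], Triple [P A, P A] [] []),
    (Triple [N B, P A] [] [], [True, True, True], Triple [P A, P A, P A, P A] [] []),
    (Triple [N B, P A] [] [], [False, True, False], Triple [N A, N A, N A, N A] [] []),
    (Triple [P A] [P C] [], [False], Triple [P B] [N A, P B, P A] []),
    (Triple [N C, P A] [] [], [True, True], Triple [P A, P A] [] []),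
    (Triple [P B, P A] [] [], [True, True], Triple [P A, P A] [] []),
    (Triple [P B, P A] [] [], [False, False], Triple [P A, P A] [] []),
    (Triple [N C, P A] [] [], [True, True, True], Triple [P A, P A] [] []),
    (Triple [N C, P A] [] [], [True, False, True], Triple [P A, P A] [] []),
    (Triple [P B] [] [], [True, True, False], Triple [N A, N A, N A, N A] [] []),
    (Triple [P A] [] [], [True, True, False], Triple [N A, N A, N A, N A] [] []),
    (Triple [N C, P A] [] [], [False, False, False, False], Triple [N A, N A, N A, N A] [] []),
    (Triple [P C, P B] [P A] [], [True], Triple [P B, P B] [P A, P B] []),
    (Triple [P C, P B] [P A] [], [False], Triple [P B, P B] [P A, P B] []),
    (Triple [P C, P A] [P B] [], [True], Triple [P B, P B] [P A, P B] []),
    (Triple [P C, P A] [P B] [], [False], Triple [P B, P B] [P A, P B] []),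
    (Triple [P A] [P C] [], [True], Triple [P A, P A, N B] [P B] []),
    (Triple [P A] [P C] [], [False], Triple [P A, P A, N B] [P B] []),
    (Triple [P A] [P B] [P C], [True], Triple [P C] [N A, P B, P A] [P B]),
    (Triple [P A] [P B] [P C], [False], Triple [P C] [N A, P B, P A] [P B]),
    (Triple [P A] [P B] [P C], [False], Triple [P B] [P A, P A, N C] [P C]),
    (Triple [P A] [P B] [P C], [True], Triple [P C] [P A, P B, P C, P A, P B] [P B]),
    (Triple [P A] [P B] [P C], [True], Triple [P B] [P C] [P C, P A, P B, P A, P C]),
    (Triple [P A] [P B] [P C], [False], Triple [P C] [P A, P B, P C, P A, P B] [P B]),
    (Triple [P A] [P B] [P C], [False], Triple [P B] [P C] [P C, P A, P B, P A, P C]),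
    (Triple [P A] [P B] [P C], [True], Triple [P C] [P A, P A, N C] [P B, P A, N C]),
    (Triple [P A] [P B] [P C], [False], Triple [P C] [P A, P A, N C] [P B, P A, N C]),
    (Triple [P C, P A] [] [], [True, True], Triple [P A, P A] [] []),
    (Triple [P C, P A] [] [], [True, False], Triple [P A, P A] [] []),
    (Triple [N C, P B] [] [], [True, True, True, True], Triple [N A, N A, N A, N A] [] []),
    (Triple [N C, P B] [] [], [False, False, False, False], Triple [N A, N A, N A, N A] [] []),
    (Triple [P B, P A] [] [], [True, True, True, True], Triple [N A, N A, N A, N A] [] []),
    (Triple [P B, P A] [] [], [False, False, False, False], Triple [N A, N A, N A, N A] [] []),
    (Triple [P B] [P C] [], [True], Triple [P B] [N A, P B, P A] []),
    (Triple [P B] [P C] [], [False], Triple [P B] [N A, P B, P A] []),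
    (Triple [P A] [P B] [P C], [True], Triple [P C] [P B] [P A, P A, N B]),
    (Triple [P A] [P B] [P C], [True], Triple [P A, P A, N C] [P C] [P B]),
    (Triple [P A] [P B] [P C], [True], Triple [P B] [P C] [N A, P B, P A]),
    (Triple [P A] [P B] [P C], [True], Triple [P B] [P C] [P A, N B, P A]),
    (Triple [P A] [P B] [P C], [True], Triple [P B] [P A, P A, N C] [P C]),
    (Triple [P A] [P B] [P C], [True], Triple [P A, P A, N B] [P C] [P B]),
    (Triple [P A] [P B] [P C], [False], Triple [P C] [P B] [P A, P A, N B]),
    (Triple [P A] [P B] [P C], [False], Triple [P A, P A, N C] [P C] [P B]),
    (Triple [P A] [P B] [P C], [False], Triple [P B] [P C] [N A, P B, P A]),
    (Triple [P A] [P B] [P C], [False], Triple [P B] [P C] [P A, N B, P A]),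
    (Triple [P A] [P B] [P C], [False], Triple [P A, P A, N B] [P C] [P B]),
    (Triple [P A] [P B] [P C], [True], Triple [P C] [P B, P A, P B, P A, P B] [P B]),
    (Triple [P A] [P B] [P C], [False], Triple [P C] [P B, P A, P B, P A, P B] [P B]),
    (Triple [P A] [P B] [P C], [True], Triple [P A, N B, P C] [P A, N C, P A] [P C]),
    (Triple [P A] [P B] [P C], [True], Triple [P B, N A, P C] [P C] [N A, P C, P A]),
    (Triple [P A] [P B] [P C], [True], Triple [P C] [P B, N A, P C] [P B, N C, P A]),
    (Triple [P A] [P B] [P C], [True], Triple [P C] [P A, P B, N C] [P B, N C, P A]),
    (Triple [P A] [P B] [P C], [True], Triple [P C] [P A, P A, N C] [N B, P C, P B]),
    (Triple [P A] [P B] [P C], [True], Triple [P C] [N B, P C, P B] [N B, P C, P A]),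
    (Triple [P A] [P B] [P C], [True], Triple [P C] [N A, P C, P A] [P A, N B, P C]),
    (Triple [P A] [P B] [P C], [True], Triple [P C] [P B, N C, P A] [P A, P B, N C]),
    (Triple [P A] [P B] [P C], [True], Triple [P B, P A, N C] [P C] [P A, P A, N C]),
    (Triple [P A] [P B] [P C], [True], Triple [P B, P A, N C] [P C] [P A, N C, P B]),
    (Triple [P A] [P B] [P C], [True], Triple [N A, P C, P B] [N A, P C, P A] [P C]),
    (Triple [P A] [P B] [P C], [True], Triple [P A, N C, P B] [P C] [P B, P A, N C]),
    (Triple [P A] [P B] [P C], [True], Triple [P A, N C, P B] [P A, P A, N C] [P C]),
    (Triple [P A] [P B] [P C], [True], Triple [N A, P C, P A] [P C] [P B, N A, P C]),
    (Triple [P A] [P B] [P C], [True], Triple [N A, P C, P A] [P C] [P A, P B, N C]),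
    (Triple [P A] [P B] [P C], [True], Triple [N A, P C, P A] [P C] [N A, P C, P B])]"

text \<open>The parity test goes first because it involves no computation with words.\<close>

definition classified :: "table \<Rightarrow> bool" where
  "classified t \<longleftrightarrow> (if any (odd_certificate t) odd_certificate_list then True
     else if any (finite_certificate t) finite_certificate_list then True
     else any (self_similar_certificate t) self_similar_certificate_list)"

subsection \<open>Soundness\<close>

lemma every_iff: "every f xs \<longleftrightarrow> (\<forall>x\<in>set xs. f x)"
  by (induction xs) auto

lemma any_iff: "any f xs \<longleftrightarrow> (\<exists>x\<in>set xs. f x)"
  by (induction xs) auto

section \<open>Inverses and sections of words\<close>

lemma act_Nil [simp]: "act t [] v = v"
  and act_Cons [simp]: "act t (l # w) v = act t w (run t l v)"
  and act_append [simp]: "act t (w @ u) v = act t u (act t w v)"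
  by (simp_all add: act_def)

lemma act_empty [simp]: "act t w [] = []"
  by (induction w) auto

lemma opposite_opposite [simp]: "opposite (opposite l) = l"
  by (cases l) auto

lemma flips_opposite [simp]: "flips t (opposite l) = flips t l"
  by (cases l) auto

lemma child_opposite: "child t (opposite l) (b \<noteq> flips t l) = opposite (child t l b)"
  by (cases l; cases b) auto

lemma run_opposite [simp]: "run t (opposite l) (run t l v) = v"
proof (induction v arbitrary: l)
  case (Cons b v)
  then show ?case
    using child_opposite[of t l b] by auto
qed auto

lemma act_inverse_word [simp]: "act t (inverse_word w) (act t w v) = v"
proof (induction w arbitrary: v)
  case (Cons l w)
  have "inverse_word (l # w) = inverse_word w @ [opposite l]"
    by (simp add: inverse_word_def)
  then show ?case using Cons by simp
qed (simp add: inverse_word_def)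

lemma inverse_word_inverse_word [simp]: "inverse_word (inverse_word w) = w"
  by (simp add: inverse_word_def rev_map comp_def)

lemma act_inverse_word' [simp]: "act t w (act t (inverse_word w) v) = v"
  using act_inverse_word[of t "inverse_word w"] by simp

lemma act_push [simp]: "act t (push l w) v = act t w (run t l v)"
  by (cases w) auto

lemma act_foldr_push [simp]: "act t (foldr push w []) v = act t w v"
  by (induction w arbitrary: v) auto

lemma act_vertex: "act t w (b # v) = root_image t w b # act t (section_at t w b) v"
  by (induction w arbitrary: b v) auto

lemma act_vertex_image:
  "act t w (v @ y) = vertex_image t w v @ act t (section_along t w v) y"
  by (induction v arbitrary: w) (auto simp: act_vertex)

lemma act_eq_vertex_image: "act t w v = vertex_image t w v"
  using act_vertex_image[of t w v "[]"] by simp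

text \<open>Each letter translates the first entry by a constant modulo 2, and so does a word; its
  value at \<open>False\<close> tells whether it flips.\<close>

lemma root_image_shift: "root_image t w b \<longleftrightarrow> b \<noteq> root_image t w False"
proof (induction w arbitrary: b)
  case (Cons l w)
  then show ?case
    by (metis (full_types) root_image.simps(2))
qed auto

section \<open>Triviality and nontriviality of words\<close>

text \<open>Invariant of the search: words in \<open>seen\<close> are exempt from closedness because
  an outer call supplies their sections. With \<open>seen\<close> empty, \<open>S\<close> is closed
  without exception.\<close>

lemma closes_closed_set:
  "closes t n seen todo \<Longrightarrow> \<exists>S. set todo \<subseteq> S \<and> (\<forall>w\<in>S. w \<in> set seen \<or> w = [] \<or>
     \<not> root_image t w False \<and> section_at t w False \<in> S \<and> section_at t w True \<in> S)"
proof (induction t n seen todo rule: closes.induct)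
  case (1 t n seen)
  show ?case by (rule exI[of _ "{}"]) simp
next
  case (2 t seen w ws)
  then show ?case by simp
next
  case (3 t n seen w ws)
  show ?case
  proof (cases "w = [] \<or> w \<in> set seen")
    case True
    then obtain S where "set ws \<subseteq> S" "\<forall>w\<in>S. w \<in> set seen \<or> w = [] \<or>
      \<not> root_image t w False \<and> section_at t w False \<in> S \<and> section_at t w True \<in> S"
      using 3 by auto
    then show ?thesis using True by (intro exI[of _ "insert w S"]) auto
  next
    case False
    then have r: "\<not> root_image t w False" using "3.prems" by (auto split: if_splits)
    with False obtain S
      where "set (section_at t w False # section_at t w True # ws) \<subseteq> S"
        "\<forall>u\<in>S. u \<in> set (w # seen) \<or> u = [] \<or>
           \<not> root_image t u False \<and> section_at t u False \<in> S \<and> section_at t u True \<in> S"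
      using 3 by auto
    then show ?thesis using r by (intro exI[of _ "insert w S"]) auto
  qed
qed

text \<open>Induction on the vertex for all words of the closed set at once: each fixes the first
  entry and passes to a section that lies in the set again.\<close>

lemma trivial_imp_act_eq:
  assumes "trivial t w"
  shows "act t w = id"
proof -
  obtain S where w: "foldr push w [] \<in> S"
    and S: "\<And>u. u \<in> S \<Longrightarrow> u = [] \<or>
      \<not> root_image t u False \<and> section_at t u False \<in> S \<and> section_at t u True \<in> S"
    using closes_closed_set[OF assms[unfolded trivial_def]] by auto
  have "act t u v = v" if "u \<in> S" for u v
    using that
  proof (induction v arbitrary: u)
    case (Cons b v)
    show ?case
      using S[OF Cons.prems] Cons.IH root_image_shift[of t u b]
      by (cases b) (auto simp: act_vertex)
  qed simp
  then have "act t w v = v" for v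
    using w act_foldr_push by metis
  then show ?thesis by auto
qed

lemma nontrivial_imp_moves: "nontrivial t n w \<Longrightarrow> act t w \<noteq> id"
proof (induction n arbitrary: w)
  case (Suc n)
  consider (root) "root_image t w False"
    | (below) b where "\<not> root_image t w False" "nontrivial t n (section_at t w b)"
    using Suc.prems by (auto split: if_splits)
  then show ?case
  proof cases
    case root
    then have "act t w [False] = [True]" by (simp add: act_vertex)
    then show ?thesis by auto
  next
    case below
    then obtain v where "act t (section_at t w b) v \<noteq> v"
      using Suc.IH by fastforce
    then have "act t w (b # v) \<noteq> b # v" by (simp add: act_vertex)
    then show ?thesis by auto
  qed
qed simp

section \<open>Infinite order from parities\<close>

definition letter_state :: "letter \<Rightarrow> state" where
  "letter_state l = (case l of P q \<Rightarrow> q | N q \<Rightarrow> q)"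

text \<open>The homomorphism from the free group on the states to the vectors over the field with
  two elements, where a state and its inverse have the same image.\<close>

fun parities :: "word \<Rightarrow> bool triple" where
  "parities [] = Triple False False False"
| "parities (l # w) = xor3 (unit3 (letter_state l)) (parities w)"

lemma xor3_simps:
  "xor3 x (xor3 y z) = xor3 (xor3 x y) z"
  "xor3 x y = xor3 y x"
  "xor3 x (xor3 y z) = xor3 y (xor3 x z)"
  "xor3 x x = Triple False False False"
  "xor3 x (Triple False False False) = x"
  "xor3 (Triple False False False) x = x"
  by (cases x; cases y; cases z; auto)+

lemma parities_append: "parities (u @ w) = xor3 (parities u) (parities w)"
  by (induction u) (simp_all add: xor3_simps(1,6))

lemma xor3_cancel: "xor3 x (xor3 x y) = y"
  by (cases x; cases y) auto

lemma letter_state_opposite [simp]: "letter_state (opposite l) = letter_state l"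
  by (cases l) (auto simp: letter_state_def)

text \<open>Cancelling a letter against its inverse drops the same unit vector twice, which is zero
  modulo 2.\<close>

lemma parities_push [simp]: "parities (push l w) = xor3 (unit3 (letter_state l)) (parities w)"
  by (cases w) (auto simp: xor3_cancel)

lemma odd_flips_xor3: "odd_flips t (xor3 c d) \<longleftrightarrow> odd_flips t c \<noteq> odd_flips t d"
  by (cases c; cases d) (auto simp: odd_flips_def)

lemma odd_flips_unit3: "odd_flips t (unit3 q) = active (entry t q)"
  by (cases q) (auto simp: odd_flips_def unit3_def)

lemma flips_letter_state: "flips t l = active (entry t (letter_state l))"
  by (cases l) (auto simp: letter_state_def)

lemma root_image_parities: "root_image t w False = odd_flips t (parities w)"
proof (induction w)
  case Nil
  then show ?case by (simp add: odd_flips_def)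
next
  case (Cons l w)
  then show ?case
    using root_image_shift[of t w "flips t l"]
    by (auto simp: odd_flips_xor3 odd_flips_unit3 flips_letter_state)
qed

lemma next_class_xor3: "next_class t (xor3 c d) = xor3 (next_class t c) (next_class t d)"
proof -
  have scale: "scale3 (a \<noteq> b) x = xor3 (scale3 a x) (scale3 b x)" for a b x
    by (cases x) (auto simp: scale3_def)
  have mid: "xor3 (xor3 a1 b1) (xor3 (xor3 a2 b2) (xor3 a3 b3)) =
    xor3 (xor3 a1 (xor3 a2 a3)) (xor3 b1 (xor3 b2 b3))" for a1 a2 a3 b1 b2 b3
    by (cases a1; cases a2; cases a3; cases b1; cases b2; cases b3) auto
  show ?thesis
    by (cases c; cases d) (simp only: next_class_def xor3.simps entry.simps scale mid)
qed

lemma next_class_unit3: "next_class t (unit3 q) = below (entry t q)"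
  by (cases q) (simp_all add: next_class_def unit3_def scale3_def xor3_simps(5,6))

lemma child_parities:
  "xor3 (unit3 (letter_state (child t l False))) (unit3 (letter_state (child t l True)))
     = below (entry t (letter_state l))"
  by (cases l; cases "active (entry t (letter_state l))")
     (auto simp: below_def letter_state_def xor3_simps(2))

text \<open>Each section alone depends on the order of the letters, but in the sum over both
  children every letter contributes both of its sections.\<close>

lemma section_parities:
  "xor3 (parities (section_at t w False)) (parities (section_at t w True))
     = next_class t (parities w)"
proof (induction w)
  case Nil
  then show ?case by (simp add: next_class_def scale3_def)
next
  case (Cons l w)
  have mid: "xor3 (xor3 a b) (xor3 c d) = xor3 (xor3 a c) (xor3 b d)" for a b c d
    by (cases a; cases b; cases c; cases d) auto
  \<comment> \<open>A flip by the first letter only exchanges the children met by the rest of the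
    word, and the sum is symmetric in them.\<close>
  have "xor3 (parities (section_at t w (False \<noteq> flips t l)))
      (parities (section_at t w (True \<noteq> flips t l))) = next_class t (parities w)"
    using Cons by (cases "flips t l") (auto simp: xor3_simps(2))
  then show ?case
    by (simp add: next_class_xor3 next_class_unit3 mid child_parities del: not_True_eq_False)
qed

text \<open>Since \<open>w\<close> flips the root, its square fixes both children, and below
  \<open>False\<close> it acts as the product of the two sections of \<open>w\<close>. The parities
  of this product are again certified, so the exponent can be halved inductively.\<close>

lemma odd_power_moves:
  assumes "odd_certificate t cs" "parities w \<in> set cs"
  shows "act t w ^^ (2 ^ n) \<noteq> id"
proof -
  have cs: "odd_flips t c" "next_class t c \<in> set cs" if "c \<in> set cs" for c
    using assms(1) that by (auto simp: odd_certificate_def every_iff stays_odd_def split: if_splits)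
  have "\<exists>v. (act t w ^^ (2 ^ n)) v \<noteq> v"
    using assms(2)
  proof (induction n arbitrary: w)
    case 0
    then have "act t w [False] \<noteq> [False]"
      using cs(1) root_image_parities by (simp add: act_vertex)
    then show ?case by auto
  next
    case (Suc n)
    let ?u = "section_at t w False @ section_at t w True"
    have flip: "root_image t w False" "\<not> root_image t w True"
      using Suc.prems cs(1) root_image_parities[of t w] root_image_shift[of t w True] by auto
    have "parities ?u \<in> set cs"
      using Suc.prems cs(2) section_parities by (simp add: parities_append)
    then obtain v where v: "(act t ?u ^^ (2 ^ n)) v \<noteq> v" using Suc.IH by blast
    \<comment> \<open>Two passes through \<open>w\<close> lead from \<open>False\<close> to
      \<open>True\<close> and back and collect the two sections in this order.\<close>
    have two: "(act t w ^^ 2) (False # y) = False # act t ?u y" for y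
      using flip by (simp add: numeral_2_eq_2 act_vertex)
    have "((act t w ^^ 2) ^^ k) (False # y) = False # (act t ?u ^^ k) y" for k y
      by (induction k) (simp_all add: two)
    then have "(act t w ^^ (2 ^ Suc n)) (False # v) = False # (act t ?u ^^ (2 ^ n)) v"
      by (simp add: funpow_mult)
    then show ?case using v by (metis list.inject)
  qed
  then show ?thesis by auto
qed

lemma ex_odd_times_power_of_two:
  assumes "(n::nat) > 0"
  shows "\<exists>k m. n = k * 2 ^ m \<and> odd k"
  using assms
proof (induction n rule: less_induct)
  case (less n)
  show ?case
  proof (cases "even n")
    case True
    then obtain n' where n': "n = 2 * n'" by blast
    then obtain k m where "n' = k * 2 ^ m" "odd k"
      using less.IH[of n'] less.prems by auto
    then show ?thesis using n' by (intro exI[of _ k] exI[of _ "Suc m"]) simp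
  next
    case False
    then show ?thesis by (intro exI[of _ n] exI[of _ 0]) simp
  qed
qed

lemma act_bij: "bij (act t w)"
  by (rule bij_betw_byWitness[of _ "act t (inverse_word w)"]) auto

lemma act_word_power: "act t (word_power w n) = act t w ^^ n"
proof (induction n)
  case (Suc n)
  show ?case
  proof
    fix v
    have "act t (word_power w (Suc n)) v = (act t w ^^ n) (act t w v)"
      using Suc by (simp add: word_power_def)
    then show "act t (word_power w (Suc n)) v = (act t w ^^ Suc n) v"
      by (simp add: funpow_swap1)
  qed
qed (auto simp: word_power_def)

text \<open>An odd multiple of a vector modulo 2 is the vector itself; this lets odd powers of a
  word inherit its certificate.\<close>

lemma parities_odd_power:
  assumes "odd n"
  shows "parities (word_power w n) = parities w"
proof -
  have "parities (word_power w (Suc (2 * k))) = parities w" for k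
    by (induction k) (simp_all add: word_power_def parities_append xor3_simps(4,5) xor3_cancel)
  then show ?thesis using assms by (auto elim!: oddE)
qed

text \<open>Certificates list vectors only; this supplies a word to which they apply.\<close>

lemma ex_parities: "\<exists>w. parities w = c"
proof (cases c)
  case (Triple x y z)
  have "parities ((if x then [P A] else []) @ (if y then [P B] else [])
      @ (if z then [P C] else [])) = c"
    using Triple by (simp add: unit3_def letter_state_def)
  then show ?thesis by blast
qed

text \<open>In a finite group two powers of a certified word coincide, so a positive power of it is
  the identity. The list must be nonempty since the empty one passes vacuously.\<close>

lemma odd_certificate_infinite:
  assumes "odd_certificate t cs" "cs \<noteq> []"
  shows "infinite (range (act t))"
proof
  assume fin: "finite (range (act t))"
  obtain w where w: "parities w \<in> set cs"
    using assms(2) ex_parities by (metis last_in_set)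
  have "(\<lambda>n. act t w ^^ n) ` UNIV \<subseteq> range (act t)"
    by (auto simp flip: act_word_power)
  then have "\<not> inj (\<lambda>n::nat. act t w ^^ n)"
    using fin by (meson finite_imageD finite_subset infinite_UNIV_nat)
  then obtain i j :: nat where ij: "act t w ^^ i = act t w ^^ j" "i < j"
    unfolding inj_def by (metis nat_neq_iff)
  have "act t w ^^ j = (act t w ^^ i) \<circ> (act t w ^^ (j - i))"
    using ij(2) by (simp flip: funpow_add)
  then have "(act t w ^^ i) ((act t w ^^ (j - i)) v) = (act t w ^^ i) v" for v
    using ij(1) by (metis comp_apply)
  moreover have "inj (act t w ^^ i)"
    by (intro inj_fn bij_is_inj act_bij)
  ultimately have one: "act t w ^^ (j - i) = id"
    by (auto simp: inj_def)
  \<comment> \<open>The odd part of the exponent is absorbed into the word, whose parities it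
    preserves; the remaining power of two contradicts \<open>odd_power_moves\<close>.\<close>
  obtain m o' where m: "j - i = o' * 2 ^ m" "odd o'"
    using ex_odd_times_power_of_two[of "j - i"] ij(2) by auto
  have "act t (word_power w o') ^^ (2 ^ m) = id"
    using one m(1) by (simp add: act_word_power funpow_mult mult.commute)
  then show False
    using odd_power_moves[OF assms(1), of "word_power w o'" m] parities_odd_power[OF m(2), of w] w
    by simp
qed

section \<open>Infinite groups from self-similar subgroups\<close>

lemma inverse_word_append: "inverse_word (u @ w) = inverse_word w @ inverse_word u"
  by (simp add: inverse_word_def)

lemma subst_append: "subst s (u @ w) = subst s u @ subst s w"
  by (simp add: subst_def)

lemma subst_Nil [simp]: "subst s [] = []"
  by (simp add: subst_def)

lemma subst_Cons: "subst s (l # w) = letter_subst s l @ subst s w"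
  by (simp add: subst_def)

lemma letter_subst_opposite: "letter_subst s (opposite l) = inverse_word (letter_subst s l)"
  by (cases l) auto

lemma subst_inverse_word: "subst s (inverse_word w) = inverse_word (subst s w)"
proof (induction w)
  case (Cons l w)
  have "inverse_word (l # w) = inverse_word w @ [opposite l]"
    by (simp add: inverse_word_def)
  then show ?case
    using Cons by (simp add: subst_append subst_Cons inverse_word_append letter_subst_opposite)
qed (simp add: inverse_word_def)

text \<open>A finite group cannot act on a vertex with a proper stabilizer whose sections give back
  the whole group.\<close>

lemma self_similar_certificate_infinite:
  assumes "self_similar_certificate t (s, v, u)"
  shows "infinite (range (act t))"
proof
  assume fin: "finite (range (act t))"
  have rep: "reproduces t s v u q" for q
    using assms by (cases q) (auto simp: every_iff states_def split: if_splits)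
  have mov: "\<exists>q. moves t s v q"
    using assms by (auto simp: any_iff split: if_splits)
  \<comment> \<open>Replacing generators by their lifts in \<open>u\<close> turns any element of the
    subgroup into one that fixes \<open>v\<close> and has the given element as its section
    there.\<close>
  have lift: "act t (subst s (subst u w)) (v @ y) = v @ act t (subst s w) y" for w y
  proof (induction w arbitrary: y)
    case (Cons l w)
    have gen: "act t (subst s (entry u q)) (v @ y) = v @ act t (entry s q) y" for q y
    proof -
      let ?h = "subst s (entry u q)"
      have h: "vertex_image t ?h v = v"
        and "trivial t (section_along t ?h v @ inverse_word (entry s q))"
        using rep[of q] by (auto simp: reproduces_def reproduces_word_def split: if_splits)
      then have "act t (inverse_word (entry s q)) (act t (section_along t ?h v) y) = y"
        using trivial_imp_act_eq by (metis act_append id_apply)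
      then have "act t (section_along t ?h v) y = act t (entry s q) y"
        by (metis act_inverse_word')
      then show ?thesis using h by (simp add: act_vertex_image)
    qed
    have "act t (subst s (letter_subst u l)) (v @ y) = v @ act t (letter_subst s l) y" for y
    proof (cases l)
      case (P q)
      then show ?thesis using gen by simp
    next
      case (N q)
      \<comment> \<open>An inverse lift is handled by writing \<open>v @ y\<close> as an image under
        the lift itself.\<close>
      have "v @ y = act t (subst s (entry u q)) (v @ act t (inverse_word (entry s q)) y)"
        by (simp add: gen)
      then show ?thesis using N by (simp add: subst_inverse_word)
    qed
    then show ?case using Cons by (simp add: subst_Cons subst_append)
  qed simp
  define K where "K = range (\<lambda>w. act t (subst s w))"
  define T where "T = {f \<in> K. f v = v}"
  have K: "finite K"
    unfolding K_def by (rule finite_subset[OF _ fin]) auto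
  obtain q where "act t (entry s q) v \<noteq> v"
    using mov by (auto simp: moves_def act_eq_vertex_image)
  moreover have "act t (entry s q) = act t (subst s [P q])"
    by (simp add: subst_Cons)
  ultimately have "T \<subset> K"
    unfolding T_def K_def by blast
  then have "card T < card K"
    using K psubset_card_mono by blast
  \<comment> \<open>Taking sections at \<open>v\<close> maps the stabilizer \<open>T\<close> onto
    all of \<open>K\<close>, so \<open>T\<close> cannot have fewer elements.\<close>
  moreover have "K \<subseteq> (\<lambda>f y. drop (length v) (f (v @ y))) ` T"
  proof
    fix f assume "f \<in> K"
    then obtain w where f: "f = act t (subst s w)" by (auto simp: K_def)
    let ?g = "act t (subst s (subst u w))"
    have "f = (\<lambda>y. drop (length v) (?g (v @ y)))"
      by (simp add: lift f)
    moreover have "?g v = v" using lift[of w "[]"] by simp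
    then have "?g \<in> T" by (simp add: T_def K_def)
    ultimately show "f \<in> (\<lambda>f y. drop (length v) (f (v @ y))) ` T" by blast
  qed
  moreover have "finite T"
    using K by (simp add: T_def)
  ultimately show False
    using surj_card_le by (metis not_less)
qed

section \<open>Dihedral groups and their relations\<close>

lemma group_dihedral_group:
  assumes "n > 0"
  shows "group (dihedral_group n)"
proof (rule groupI)
  fix x y z
  assume xyz: "x \<in> carrier (dihedral_group n)" "y \<in> carrier (dihedral_group n)"
    "z \<in> carrier (dihedral_group n)"
  obtain i j k l m p where e: "x = (i, j)" "y = (k, l)" "z = (m, p)"
    by (metis surj_pair)
  have j: "j = 0 \<or> j = 1" "l = 0 \<or> l = 1" "p = 0 \<or> p = 1"
    using xyz by (auto simp: e dihedral_group_def)
  show "x \<otimes>\<^bsub>dihedral_group n\<^esub> y \<otimes>\<^bsub>dihedral_group n\<^esub> z =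
    x \<otimes>\<^bsub>dihedral_group n\<^esub> (y \<otimes>\<^bsub>dihedral_group n\<^esub> z)"
    using j by (elim disjE) (simp_all add: e dihedral_group_def mod_simps algebra_simps)
next
  fix x y
  assume "x \<in> carrier (dihedral_group n)" "y \<in> carrier (dihedral_group n)"
  then show "x \<otimes>\<^bsub>dihedral_group n\<^esub> y \<in> carrier (dihedral_group n)"
    using assms by (cases x; cases y) (simp add: dihedral_group_def)
next
  show "\<one>\<^bsub>dihedral_group n\<^esub> \<in> carrier (dihedral_group n)"
    using assms by (simp add: dihedral_group_def)
next
  fix x
  assume x: "x \<in> carrier (dihedral_group n)"
  obtain i j where e: "x = (i, j)" by (metis surj_pair)
  show "\<one>\<^bsub>dihedral_group n\<^esub> \<otimes>\<^bsub>dihedral_group n\<^esub> x = x"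
    using x by (simp add: e dihedral_group_def)
next
  fix x
  assume x: "x \<in> carrier (dihedral_group n)"
  obtain i j where e: "x = (i, j)" by (metis surj_pair)
  have "j = 0 \<or> j = 1"
    using x by (auto simp: e dihedral_group_def)
  then show "\<exists>y\<in>carrier (dihedral_group n).
      y \<otimes>\<^bsub>dihedral_group n\<^esub> x = \<one>\<^bsub>dihedral_group n\<^esub>"
  proof
    assume "j = 0"
    then show ?thesis
      using assms by (intro bexI[of _ "(- i mod int n, 0)"])
        (simp_all add: e dihedral_group_def mod_simps)
  next
    assume "j = 1"
    then show ?thesis
      using x by (intro bexI[of _ "(i, 1)"]) (simp_all add: e dihedral_group_def)
  qed
qed

context group
begin

lemma int_pow_mod_exponent:
  assumes "x \<in> carrier G" "x [^] (n::nat) = \<one>"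
  shows "x [^] (i mod int n) = x [^] i"
proof -
  have "x [^] i = x [^] (int n * (i div int n) + i mod int n)"
    by simp
  also have "\<dots> = (x [^] int n) [^] (i div int n) \<otimes> x [^] (i mod int n)"
    using assms(1) by (simp only: int_pow_mult int_pow_pow)
  finally show ?thesis
    using assms by (simp add: int_pow_int)
qed

text \<open>Conjugation by \<open>g\<close> is an endomorphism that takes \<open>x\<close> to
  \<open>y\<close>, hence powers to powers.\<close>

lemma int_pow_intertwine:
  assumes "g \<in> carrier G" "x \<in> carrier G" "y \<in> carrier G" "g \<otimes> x = y \<otimes> g"
  shows "g \<otimes> x [^] (i::int) = y [^] i \<otimes> g"
proof -
  have "(\<lambda>z. g \<otimes> z \<otimes> inv g) \<in> hom G G"
  proof (rule homI)
    fix a b assume "a \<in> carrier G" "b \<in> carrier G"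
    then show "g \<otimes> (a \<otimes> b) \<otimes> inv g = g \<otimes> a \<otimes> inv g \<otimes> (g \<otimes> b \<otimes> inv g)"
      using assms(1) by (simp add: m_assoc inv_solve_left)
  qed (use assms(1) in simp)
  then interpret h: group_hom G G "\<lambda>z. g \<otimes> z \<otimes> inv g"
    by unfold_locales
  have "g \<otimes> x \<otimes> inv g = y"
    using assms by (simp add: inv_solve_right')
  then have "g \<otimes> x [^] i \<otimes> inv g = y [^] i"
    using h.hom_int_pow[OF assms(2), of i] by simp
  then show ?thesis
    using assms by (simp add: inv_solve_right')
qed

text \<open>Products of normal forms are brought back to normal form by moving \<open>c\<close> to
  the right and \<open>s\<close> past powers of \<open>r\<close>, which inverts them; then exponents
  are reduced.\<close>

lemma dihedral_times_cyclic_hom: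
  assumes r: "r \<in> carrier G" "r [^] (n::nat) = \<one>" and s: "s \<in> carrier G" "s \<otimes> s = \<one>"
    and c: "c \<in> carrier G" "c [^] (k::nat) = \<one>"
    and srsr: "s \<otimes> r \<otimes> s \<otimes> r = \<one>"
    and comm: "c \<otimes> r = r \<otimes> c" "c \<otimes> s = s \<otimes> c"
    and pos: "n > 0" "k > 0"
  shows "(\<lambda>((i, j), l). r [^] (i::int) \<otimes> s [^] (j::nat) \<otimes> c [^] (l::int))
    \<in> hom (dihedral_group n \<times>\<times> integer_mod_group k) G"
proof (rule homI)
  let ?f = "\<lambda>((i, j), l). r [^] (i::int) \<otimes> s [^] (j::nat) \<otimes> c [^] (l::int)"
  fix x y
  assume x: "x \<in> carrier (dihedral_group n \<times>\<times> integer_mod_group k)"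
    and y: "y \<in> carrier (dihedral_group n \<times>\<times> integer_mod_group k)"
  show "?f x \<in> carrier G"
    using r(1) s(1) c(1) by (auto split: prod.split)
  obtain i j l i' j' l' where e: "x = ((i, j), l)" "y = ((i', j'), l')"
    by (metis surj_pair)
  have j: "j = 0 \<or> j = 1" "j' = 0 \<or> j' = 1"
    using x y by (auto simp: e dihedral_group_def)
  note cl = r(1) s(1) c(1)
  \<comment> \<open>The product \<open>s r\<close> is its own inverse, and so is \<open>s\<close>;
    this yields the dihedral rule \<open>s r = r^(-1) s\<close>.\<close>
  have "(s \<otimes> r) \<otimes> (s \<otimes> r) = \<one>"
    using srsr cl by (simp add: m_assoc)
  then have "s \<otimes> r = inv (s \<otimes> r)"
    using cl by (simp add: inv_equality)
  moreover have "inv s = s" using s by (simp add: inv_equality)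
  ultimately have "s \<otimes> r = inv r \<otimes> s"
    using cl by (simp add: inv_mult_group)
  then have sr: "s \<otimes> r [^] i = r [^] (- i) \<otimes> s" for i :: int
    using int_pow_intertwine[of s r "inv r" i] cl by (simp add: int_pow_inv int_pow_neg)
  have cr: "c [^] l \<otimes> r [^] i = r [^] i \<otimes> c [^] l" for l i :: int
    using int_pow_intertwine[of "r [^] i" c c l] int_pow_intertwine[of c r r i] cl comm(1)
    by simp
  have cs: "c [^] l \<otimes> s = s \<otimes> c [^] l" for l :: int
    using int_pow_intertwine[of s c c l] cl comm(2) by simp
  \<comment> \<open>The trailing factor \<open>z\<close> makes the rules applicable inside products
    nested to the right.\<close>
  have lcomm: "c [^] l \<otimes> (r [^] i \<otimes> z) = r [^] i \<otimes> (c [^] l \<otimes> z)"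
    "c [^] l \<otimes> (s \<otimes> z) = s \<otimes> (c [^] l \<otimes> z)"
    "s \<otimes> (r [^] i \<otimes> z) = r [^] (- i) \<otimes> (s \<otimes> z)"
    "s \<otimes> (s \<otimes> z) = z"
    "r [^] i \<otimes> (r [^] i' \<otimes> z) = r [^] (i + i') \<otimes> z"
    if "z \<in> carrier G" for z and l i i' :: int
    using that cl cr cs sr s(2) by (simp_all add: int_pow_mult flip: m_assoc)
  have "?f x \<otimes> ?f y = r [^] (i + (- 1) ^ j * i') \<otimes> s [^] ((j + j') mod 2) \<otimes> c [^] (l + l')"
    using j cl s(2) by (elim disjE) (simp_all add: e m_assoc lcomm cr cs flip: int_pow_mult)
  then show "?f (x \<otimes>\<^bsub>dihedral_group n \<times>\<times> integer_mod_group k\<^esub> y) = ?f x \<otimes> ?f y"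
    using cl pos
    by (simp add: e dihedral_group_def integer_mod_group_def int_pow_mod_exponent r(2) c(2))
qed

end

section \<open>Recognizing a dihedral group times a cyclic group\<close>

text \<open>The automaton group on Boolean words. Because inverse states are letters, the maps of
  all words are closed under inverses.\<close>

definition word_group :: "table \<Rightarrow> (bool list \<Rightarrow> bool list) monoid" where
  "word_group t = \<lparr>carrier = range (act t), monoid.mult = (\<circ>), one = id\<rparr>"

lemma word_group_simps [simp]:
  "carrier (word_group t) = range (act t)"
  "f \<otimes>\<^bsub>word_group t\<^esub> g = f \<circ> g"
  "\<one>\<^bsub>word_group t\<^esub> = id"
  by (simp_all add: word_group_def)

lemma act_comp: "act t u \<circ> act t w = act t (w @ u)"
  by auto

lemma act_Nil_id: "act t [] = id"
  by auto

lemma group_word_group: "group (word_group t)"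
proof (rule groupI)
  fix f assume "f \<in> carrier (word_group t)"
  then obtain w where f: "f = act t w" by auto
  have "act t (inverse_word w) \<circ> f = id" by (auto simp: f)
  then show "\<exists>g\<in>carrier (word_group t). g \<otimes>\<^bsub>word_group t\<^esub> f = \<one>\<^bsub>word_group t\<^esub>"
    by auto
next
  show "\<one>\<^bsub>word_group t\<^esub> \<in> carrier (word_group t)"
    using act_Nil_id[of t] by (metis word_group_simps(1,3) rangeI)
qed (auto simp: act_comp comp_assoc)

lemma word_group_nat_pow: "act t w [^]\<^bsub>word_group t\<^esub> (n::nat) = act t (word_power w n)"
  by (induction n) (simp_all add: act_word_power act_Nil_id flip: funpow_Suc_right)

lemma word_group_int_pow:
  "i \<ge> 0 \<Longrightarrow> act t w [^]\<^bsub>word_group t\<^esub> (i::int) = act t (word_power w (nat i))"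
  using monoid.nat_pow_closed int_pow_int[of "word_group t" "act t w" "nat i"]
  by (simp add: word_group_nat_pow)

text \<open>The relations make the normal form map a homomorphism, faithfulness on normal forms
  kills its kernel, and its image is a subgroup that contains every state.\<close>

lemma word_group_iso_dihedral_times_cyclic:
  assumes pos: "n > 0" "k > 0"
    and rel: "act t (word_power r n) = id" "act t (word_power s 2) = id"
      "act t (word_power c k) = id" "act t (r @ s @ r @ s) = id"
      "act t (c @ r @ inverse_word c @ inverse_word r) = id"
      "act t (c @ s @ inverse_word c @ inverse_word s) = id"
    and faithful: "\<And>i j l. i < n \<Longrightarrow> j < 2 \<Longrightarrow> l < k \<Longrightarrow> act t (normal_word r s c (i, j, l)) = id \<Longrightarrow>
      i = 0 \<and> j = 0 \<and> l = 0"
    and gen: "\<And>q. \<exists>i j l. act t [P q] = act t (normal_word r s c (i, j, l))"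
  shows "word_group t \<cong> dihedral_group n \<times>\<times> integer_mod_group k"
proof -
  let ?D = "dihedral_group n \<times>\<times> integer_mod_group k"
  let ?W = "word_group t"
  let ?f = "\<lambda>((i, j), l). act t r [^]\<^bsub>?W\<^esub> (i::int) \<otimes>\<^bsub>?W\<^esub> act t s [^]\<^bsub>?W\<^esub> (j::nat)
    \<otimes>\<^bsub>?W\<^esub> act t c [^]\<^bsub>?W\<^esub> (l::int)"
  interpret W: group ?W by (rule group_word_group)
  interpret D: group ?D
    by (intro DirProd_group group_dihedral_group pos group_integer_mod_group)
  have commute: "act t u \<circ> act t w = act t w \<circ> act t u"
    if "act t (u @ w @ inverse_word u @ inverse_word w) = id" for u w
  proof
    fix v
    have "act t (inverse_word w) (act t (inverse_word u) (act t w (act t u v))) = v"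
      using fun_cong[OF that, of v] by simp
    then show "(act t u \<circ> act t w) v = (act t w \<circ> act t u) v"
      by (metis act_inverse_word' comp_apply)
  qed
  have "act t s \<circ> act t s = id"
    using rel(2) by (simp add: act_word_power numeral_2_eq_2)
  moreover have "act t s \<circ> act t r \<circ> act t s \<circ> act t r = id"
    using rel(4) by (auto simp: fun_eq_iff)
  ultimately have hom: "?f \<in> hom ?D ?W"
    using rel commute
    by (intro W.dihedral_times_cyclic_hom pos) (simp_all add: word_group_nat_pow)
  then interpret h: group_hom ?D ?W ?f
    by unfold_locales
  have f: "?f ((i, j), l) = act t (normal_word r s c (nat i, j, nat l))"
    if "i \<ge> 0" "l \<ge> 0" for i l :: int and j :: nat
    using that by (simp add: word_group_int_pow word_group_nat_pow act_comp)
  have "inj_on ?f (carrier ?D)"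
  proof (rule h.inj_on_one_iff[THEN iffD2], intro allI impI)
    fix x assume x: "x \<in> carrier ?D" "?f x = \<one>\<^bsub>?W\<^esub>"
    obtain i j l where e: "x = ((i, j), l)" by (metis surj_pair)
    have b: "0 \<le> i" "i < int n" "j < 2" "0 \<le> l" "l < int k"
      using x(1) pos by (simp_all add: e dihedral_group_def carrier_integer_mod_group)
    have "act t (normal_word r s c (nat i, j, nat l)) = id"
      using x(2) f[OF b(1,4), of j] unfolding e word_group_simps by (rule trans[OF sym, rotated])
    then have "nat i = 0 \<and> j = 0 \<and> nat l = 0"
      using b by (intro faithful) simp_all
    then show "x = \<one>\<^bsub>?D\<^esub>"
      using b by (simp add: e dihedral_group_def)
  qed
  moreover have "range (act t) \<subseteq> ?f ` carrier ?D"
  proof -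
    define I where "I = ?f ` carrier ?D"
    have sub: "subgroup (I) ?W"
      unfolding I_def by (rule h.img_is_subgroup)
    have powers: "act t r [^]\<^bsub>?W\<^esub> (i::nat) \<in> I"
      "act t s [^]\<^bsub>?W\<^esub> (i::nat) \<in> I"
      "act t c [^]\<^bsub>?W\<^esub> (i::nat) \<in> I" for i
    proof -
      have powers: "act t w [^]\<^bsub>?W\<^esub> (i::nat) \<in> I"
        if "act t w \<in> I" for w
      proof (induction i)
        case 0
        then show ?case using subgroup.one_closed[OF sub] by (simp only: W.nat_pow_0)
      next
        case (Suc i)
        then show ?case
          using subgroup.m_closed[OF sub Suc that] by (simp only: W.nat_pow_Suc)
      qed
      \<comment> \<open>The preimage is \<open>1 mod int n\<close> instead of 1, since the carrier
        consists of residues and 1 is not among them if \<open>n = 1\<close>.\<close>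
      have "act t r [^]\<^bsub>?W\<^esub> (1 mod int n) = act t r"
        using W.int_pow_mod_exponent[of "act t r" n 1] rel(1) by (simp add: word_group_nat_pow)
      then have "act t r = ?f ((1 mod int n, 0), 0)" by simp
      moreover have "((1 mod int n, 0), 0) \<in> carrier ?D"
        using pos by (simp add: dihedral_group_def carrier_integer_mod_group)
      ultimately have r: "act t r \<in> I" unfolding I_def by (rule image_eqI)
      have "act t s = ?f ((0, 1), 0)" by simp
      moreover have "((0, 1), 0) \<in> carrier ?D"
        using pos by (simp add: dihedral_group_def carrier_integer_mod_group)
      ultimately have s: "act t s \<in> I" unfolding I_def by (rule image_eqI)
      have "act t c [^]\<^bsub>?W\<^esub> (1 mod int k) = act t c"
        using W.int_pow_mod_exponent[of "act t c" k 1] rel(3) by (simp add: word_group_nat_pow)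
      then have "act t c = ?f ((0, 0), 1 mod int k)" by simp
      moreover have "((0, 0), 1 mod int k) \<in> carrier ?D"
        using pos by (simp add: dihedral_group_def carrier_integer_mod_group)
      ultimately have c: "act t c \<in> I" unfolding I_def by (rule image_eqI)
      show "act t r [^]\<^bsub>?W\<^esub> (i::nat) \<in> I"
        "act t s [^]\<^bsub>?W\<^esub> (i::nat) \<in> I"
        "act t c [^]\<^bsub>?W\<^esub> (i::nat) \<in> I"
        by (intro powers r s c)+
    qed
    have P: "act t [P q] \<in> I" for q
    proof -
      obtain i j l where "act t [P q] = act t (normal_word r s c (i, j, l))"
        using gen by blast
      also have "\<dots> = act t r [^]\<^bsub>?W\<^esub> i \<otimes>\<^bsub>?W\<^esub> act t s [^]\<^bsub>?W\<^esub> j \<otimes>\<^bsub>?W\<^esub> act t c [^]\<^bsub>?W\<^esub> l"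
        by (simp add: word_group_nat_pow act_comp)
      also have "\<dots> \<in> I"
        using powers by (intro subgroup.m_closed[OF sub])
      finally show ?thesis .
    qed
    have "act t [l] \<in> I" for l
    proof (cases l)
      case (N q)
      have "act t [N q] \<circ> act t [P q] = id"
        using run_opposite[of t "P q"] by auto
      then have "act t [N q] = inv\<^bsub>?W\<^esub> (act t [P q])"
        by (intro W.inv_equality[symmetric]) simp_all
      then show ?thesis
        using N subgroup.m_inv_closed[OF sub P] by simp
    qed (use P in simp)
    then have "act t w \<in> I" for w
    proof (induction w)
      case Nil
      then show ?case using subgroup.one_closed[OF sub] by (simp add: id_def)
    next
      case (Cons l w)
      have "act t (l # w) = act t w \<otimes>\<^bsub>?W\<^esub> act t [l]" by auto
      then show ?case using Cons subgroup.m_closed[OF sub] by metis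
    qed
    then show ?thesis unfolding I_def by blast
  qed
  then have "?f ` carrier ?D = carrier ?W"
    using hom_carrier[OF hom] by (intro equalityI) simp_all
  ultimately have "?f \<in> iso ?D ?W"
    using hom by (simp add: iso_def bij_betw_def)
  then show ?thesis
    using D.iso_sym is_isoI by blast
qed

subsection \<open>From automata to tables\<close>

definition bit_word :: "bool list \<Rightarrow> bit list" where
  "bit_word = map of_bool"

definition bool_word :: "bit list \<Rightarrow> bool list" where
  "bool_word = map (\<lambda>x. x = 1)"

lemma bool_bit_word [simp]: "bool_word (bit_word v) = v"
  by (induction v) (simp_all add: bool_word_def bit_word_def)

lemma bit_bool_word [simp]: "bit_word (bool_word v) = v"
  by (induction v) (simp_all add: bool_word_def bit_word_def of_bool_def)

text \<open>The numbering \<open>e\<close> may be any bijection, which allows the states to be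
  reordered.\<close>

definition realizes :: "(nat \<Rightarrow> nat \<Rightarrow> nat) \<Rightarrow> (state \<Rightarrow> nat) \<Rightarrow> table \<Rightarrow> bool" where
  "realizes a e t \<longleftrightarrow> bij_betw e UNIV {1, 2, 3} \<and>
     (\<forall>q. a (e q) 1 = of_bool (active (entry t q)) \<and>
          a (e q) 2 = e (target (entry t q) False) \<and> a (e q) 3 = e (target (entry t q) True))"

lemma state_map_realizes:
  assumes "realizes a e t"
  shows "state_map a (e q) (bit_word v) = bit_word (act t [P q] v)"
proof (induction v arbitrary: q)
  case Nil
  then show ?case by (simp add: bit_word_def)
next
  case (Cons b v)
  have "(\<sigma> ^^ of_bool f) (of_bool b) = of_bool (b \<noteq> f)" for f
    by (cases f; cases b) (simp_all add: \<sigma>_def)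
  moreover have "(if (of_bool b :: bit) = 0 then a (e q) 2 else a (e q) 3)
      = e (target (entry t q) b)"
    using assms by (cases b) (auto simp: realizes_def)
  moreover have "a (e q) 1 = of_bool (active (entry t q))"
    using assms by (auto simp: realizes_def)
  ultimately show ?case
    using Cons by (simp add: bit_word_def)
qed

text \<open>Conjugation with the identification of Booleans and bits is the isomorphism. It remains
  to match the generated subgroup with the maps of words, by induction in both directions.\<close>

lemma automaton_group_iso_word_group:
  assumes "realizes a e t"
  shows "automaton_group a \<cong> word_group t"
proof -
  let ?l = "\<lambda>f. bit_word \<circ> f \<circ> bool_word" and ?u = "\<lambda>f. bool_word \<circ> f \<circ> bit_word"
  let ?S = "state_map a ` {1, 2, 3}"
  interpret T: group tree_aut by (rule group_tree_aut)
  have mult: "f \<otimes>\<^bsub>tree_aut\<^esub> g = f \<circ> g" and one_tree: "\<one>\<^bsub>tree_aut\<^esub> = id" for f g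
    by (simp_all add: tree_aut_def)
  have "range e = {1, 2, 3}"
    using assms by (simp only: realizes_def bij_betw_def)
  then have S: "?S = range (\<lambda>q. state_map a (e q))"
    by (metis image_image)
  have gen: "state_map a (e q) = ?l (act t [P q])" for q
    using state_map_realizes[OF assms] by (metis bit_bool_word comp_apply ext)
  have inverse: "inv\<^bsub>tree_aut\<^esub> (state_map a (e q)) = ?l (act t [N q])" for q
  proof
    fix v
    have "inv\<^bsub>tree_aut\<^esub> (state_map a (e q)) \<circ> state_map a (e q) = id"
      using T.l_inv[OF state_map_in_tree_aut] by (simp add: mult one_tree)
    moreover have "state_map a (e q) (?l (act t [N q]) v) = v"
      unfolding gen using run_opposite[of t "N q"] by simp
    ultimately show "(inv\<^bsub>tree_aut\<^esub> (state_map a (e q))) v = ?l (act t [N q]) v"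
      by (metis comp_apply id_apply)
  qed
  have carrier: "carrier (automaton_group a) = generate tree_aut ?S"
    unfolding automaton_group_def carrier_subgroup_generated
    using state_map_in_tree_aut by (intro arg_cong[where f = "generate tree_aut"]) auto
  have sub: "?l (act t w) \<in> generate tree_aut ?S" for w
  proof (induction w)
    case Nil
    have "?l (act t []) = \<one>\<^bsub>tree_aut\<^esub>" by (auto simp: one_tree)
    then show ?case using generate.one by metis
  next
    case (Cons l w)
    have "?l (act t [l]) \<in> generate tree_aut ?S"
    proof (cases l)
      case (P q)
      then show ?thesis
        using generate.incl[of "state_map a (e q)" ?S tree_aut] unfolding S gen by blast
    next
      case (N q)
      then show ?thesis
        using N generate.inv[of "state_map a (e q)" ?S tree_aut] unfolding S inverse by blast
    qed
    moreover have "?l (act t (l # w)) = ?l (act t w) \<otimes>\<^bsub>tree_aut\<^esub> ?l (act t [l])"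
      by (auto simp: mult)
    ultimately show ?case
      using Cons generate.eng by metis
  qed
  have "f \<in> ?l ` range (act t)" if "f \<in> generate tree_aut ?S" for f
    using that
  proof (induction rule: generate.induct)
    case one
    have "\<one>\<^bsub>tree_aut\<^esub> = ?l (act t [])" by (simp add: one_tree fun_eq_iff)
    then show ?case by blast
  next
    case (incl h)
    then obtain q where "h = state_map a (e q)" unfolding S by blast
    then show ?case unfolding gen by blast
  next
    case (inv h)
    then obtain q where "h = state_map a (e q)" unfolding S by blast
    then have "inv\<^bsub>tree_aut\<^esub> h = ?l (act t [N q])"
      by (simp add: inverse)
    then show ?case by blast
  next
    case (eng f g)
    then obtain u w where "f = ?l (act t u)" "g = ?l (act t w)" by blast
    then have "f \<otimes>\<^bsub>tree_aut\<^esub> g = ?l (act t (w @ u))" by (auto simp: mult)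
    then show ?case by blast
  qed
  then have carrier': "carrier (automaton_group a) = ?l ` range (act t)"
    using sub carrier by blast
  have ul: "?u (?l g) = g" for g
    by (simp add: fun_eq_iff)
  have "?u \<in> iso (automaton_group a) (word_group t)"
  proof (rule isoI)
    show "?u \<in> hom (automaton_group a) (word_group t)"
    proof (rule homI)
      fix f g
      show "?u (f \<otimes>\<^bsub>automaton_group a\<^esub> g) = ?u f \<otimes>\<^bsub>word_group t\<^esub> ?u g"
        by (simp add: automaton_group_def mult fun_eq_iff)
      assume "f \<in> carrier (automaton_group a)"
      then obtain w where "f = ?l (act t w)" unfolding carrier' by blast
      then show "?u f \<in> carrier (word_group t)"
        unfolding word_group_simps using ul by blast
    qed
    show "bij_betw ?u (carrier (automaton_group a)) (carrier (word_group t))"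
      unfolding carrier' word_group_simps
      by (rule bij_betw_byWitness[of _ ?l]) (auto simp: ul simp del: o_apply)
  qed
  then show ?thesis by (rule is_isoI)
qed

subsection \<open>Classification\<close>

lemma set_states: "set states = UNIV"
  using state.exhaust by (auto simp: states_def)

lemma finite_certificate_iso:
  assumes cert: "finite_certificate t (n, k, r, s, c, e)" and pos: "n > 0" "k > 0"
  shows "word_group t \<cong> dihedral_group n \<times>\<times> integer_mod_group k"
proof (rule word_group_iso_dihedral_times_cyclic[OF pos])
  have gen: "generated t r s c e q" for q
    using cert by (auto simp: every_iff set_states split: if_splits)
  have rel: "every (trivial t) [word_power s 2, word_power r n, word_power c k, r @ s @ r @ s,
        c @ r @ inverse_word c @ inverse_word r, c @ s @ inverse_word c @ inverse_word s]"
    using cert unfolding finite_certificate.simps by (meson if_splits(2))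
  then show "act t (word_power r n) = id" "act t (word_power s 2) = id"
      "act t (word_power c k) = id" "act t (r @ s @ r @ s) = id"
      "act t (c @ r @ inverse_word c @ inverse_word r) = id"
      "act t (c @ s @ inverse_word c @ inverse_word s) = id"
    by (auto simp only: every_iff list.set ball_simps intro!: trivial_imp_act_eq)
  have "every (nonidentity t r s c) (tl (exponents n k))"
    using cert by (auto split: if_splits)
  then have non: "act t (normal_word r s c x) \<noteq> id" if "x \<in> set (tl (exponents n k))" for x
    using that nontrivial_imp_moves by (auto simp: every_iff nonidentity_def)
  have "exponents n k = (0, 0, 0) # tl (exponents n k)"
    using pos by (simp add: exponents_def upt_conv_Cons)
  then have "set (exponents n k) = insert (0, 0, 0) (set (tl (exponents n k)))"
    by (metis list.simps(15))
  moreover have "set (exponents n k) = {..<n} \<times> {..<2} \<times> {..<k}"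
    by (auto simp: exponents_def)
  ultimately have set: "insert (0, 0, 0) (set (tl (exponents n k))) = {..<n} \<times> {..<2} \<times> {..<k}"
    by simp
  show "i = 0 \<and> j = 0 \<and> l = 0"
    if b: "i < n" "j < 2" "l < k" and one: "act t (normal_word r s c (i, j, l)) = id" for i j l
  proof -
    have "(i, j, l) \<in> insert (0, 0, 0) (set (tl (exponents n k)))"
      unfolding set using b by simp
    moreover have "(i, j, l) \<notin> set (tl (exponents n k))"
      using non one by blast
    ultimately show ?thesis by simp
  qed
  show "\<exists>i j l. act t [P q] = act t (normal_word r s c (i, j, l))" for q
  proof -
    obtain i j l where x: "entry e q = (i, j, l)" by (metis surj_pair)
    have "act t (normal_word r s c (i, j, l) @ [N q]) = id"
      using gen[of q] trivial_imp_act_eq by (auto simp: generated_def x)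
    then have "run t (N q) (act t (normal_word r s c (i, j, l)) v) = v" for v
      by (metis act_Cons act_Nil act_append id_apply)
    then have "act t [P q] v = act t (normal_word r s c (i, j, l)) v" for v
      using run_opposite[of t "N q"] by (metis act_Cons act_Nil opposite.simps(2))
    then show ?thesis by blast
  qed
qed

text \<open>In order, the pairs stand for C_2, C_2 x C_2, C_2 x C_2 x C_2, D_4 and D_4 x C_2. The
  trivial group is kept apart, as the product for \<open>(n, k)\<close> has order
  \<open>2 * n * k\<close>.\<close>

definition finite_types :: "(nat \<times> nat) set" where
  "finite_types = {(1, 1), (1, 2), (2, 2), (4, 1), (4, 2)}"

lemma finite_certificate_list_types: "\<forall>x\<in>set finite_certificate_list. (fst x, fst (snd x)) \<in> finite_types"
  by (simp add: finite_certificate_list_def finite_types_def)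

lemma classified_imp:
  assumes "classified t"
  shows "infinite (range (act t)) \<or>
    (\<exists>(n, k)\<in>finite_types. word_group t \<cong> dihedral_group n \<times>\<times> integer_mod_group k)"
proof -
  consider cs where "cs \<in> set odd_certificate_list" "odd_certificate t cs"
    | x where "x \<in> set finite_certificate_list" "finite_certificate t x"
    | x where "self_similar_certificate t x"
    using assms by (auto simp: classified_def any_iff split: if_splits)
  then show ?thesis
  proof cases
    case 1
    then show ?thesis
      using odd_certificate_infinite[of t cs] by (auto simp: odd_certificate_list_def)
  next
    case 2
    obtain n k r s c e where x: "x = (n, k, r, s, c, e)" by (metis surj_pair)
    have "(n, k) \<in> finite_types"
      using finite_certificate_list_types 2(1) by (auto simp: x)
    moreover from this have "n > 0" "k > 0" by (auto simp: finite_types_def)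
    ultimately show ?thesis
      using finite_certificate_iso 2(2) unfolding x by blast
  next
    case 3
    then show ?thesis using self_similar_certificate_infinite by (metis surj_pair)
  qed
qed

section \<open>Automata whose states are all active or all inactive\<close>

lemma run_constant:
  assumes "\<And>q. active (entry t q) = f"
  shows "run t l v = map (\<lambda>b. b \<noteq> f) v"
proof (induction v arbitrary: l)
  case (Cons b v)
  have "flips t l = f" using assms by (cases l) auto
  then show ?case using Cons by simp
qed simp

lemma inactive_iso_trivial:
  assumes "\<And>q. \<not> active (entry t q)"
  shows "word_group t \<cong> singleton_group ()"
proof -
  have "run t l v = v" for l v
    using run_constant[of t False] assms by simp
  then have "act t w v = v" for w v
    by (induction w) auto
  then have "act t w = id" for w by auto
  then have "(\<lambda>_. ()) \<in> iso (word_group t) (singleton_group ())"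
    by (auto simp: iso_def hom_def singleton_group_def bij_betw_def)
  then show ?thesis by (rule is_isoI)
qed

text \<open>All letters act as the involution that complements every entry. The group of order 2 is
  written in the form listed in \<open>finite_types\<close>.\<close>

lemma active_iso_cyclic:
  assumes "\<And>q. active (entry t q)"
  shows "word_group t \<cong> dihedral_group 1 \<times>\<times> integer_mod_group 1"
proof (rule word_group_iso_dihedral_times_cyclic[where r = "[]" and s = "[P A]" and c = "[]"])
  have run: "run t l = map Not" for l
    using run_constant[of t True] assms by auto
  show "act t (word_power [P A] 2) = id" "act t ([] @ [P A] @ [] @ [P A]) = id"
    "act t ([] @ [P A] @ inverse_word [] @ inverse_word [P A]) = id"
    by (auto simp: word_power_def numeral_2_eq_2 inverse_word_def run comp_def)
  show "i = 0 \<and> j = 0 \<and> l = 0"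
    if "i < 1" "j < 2" "l < 1" "act t (normal_word [] [P A] [] (i, j, l)) = id" for i j l
  proof -
    have "j \<noteq> 1"
    proof
      assume "j = 1"
      then have "normal_word [] [P A] [] (i, j, l) = [P A]"
        using that by (simp add: word_power_def)
      then have "act t [P A] [True] = [True]" using that(4) by simp
      then show False by (simp add: run)
    qed
    then show ?thesis using that by simp
  qed
  have "act t [P q] = act t (normal_word [] [P A] [] (0, 1, 0))" for q
    by (auto simp: word_power_def run)
  then show "\<exists>i j l. act t [P q] = act t (normal_word [] [P A] [] (i, j, l))" for q
    by blast
qed (auto simp: word_power_def inverse_word_def)

text \<open>With activity as \<open>p\<close>, this moves active states to the front; apart from the
  two uniform cases, \<open>A\<close> is then active and \<open>C\<close> is not.\<close>

lemma ex_sorted_states: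
  "\<exists>e :: state \<Rightarrow> nat. bij_betw e UNIV {1, 2, 3} \<and> (p (e C) \<longrightarrow> p (e B)) \<and> (p (e B) \<longrightarrow> p (e A))"
proof -
  have bij: "bij_betw (case_state x y z) UNIV {1, 2, 3}"
    if "{x, y, z} = {1, 2, 3::nat}" "x \<noteq> y" "y \<noteq> z" "x \<noteq> z" for x y z
    unfolding bij_betw_def
  proof
    show "inj (case_state x y z)"
      using that by (auto simp: inj_def split: state.splits)
    have "range (case_state x y z) = case_state x y z ` set states"
      by (simp only: set_states)
    also have "\<dots> = {x, y, z}" by (simp add: states_def)
    finally show "range (case_state x y z) = {1, 2, 3}" using that(1) by (rule trans)
  qed
  have ex: ?thesis if "{x, y, z} = {1, 2, 3::nat}" "x \<noteq> y" "y \<noteq> z" "x \<noteq> z"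
    "p z \<longrightarrow> p y" "p y \<longrightarrow> p x" for x y z
    using bij[OF that(1-4)] that(5,6) by (intro exI[of _ "case_state x y z"]) simp
  \<comment> \<open>For at least one of the six orders of the three numbers, the values of
    \<open>p\<close> are decreasing.\<close>
  have "(p 3 \<longrightarrow> p 2) \<and> (p 2 \<longrightarrow> p 1) \<or> (p 2 \<longrightarrow> p 3) \<and> (p 3 \<longrightarrow> p 1) \<or>
    (p 3 \<longrightarrow> p 1) \<and> (p 1 \<longrightarrow> p 2) \<or> (p 1 \<longrightarrow> p 3) \<and> (p 3 \<longrightarrow> p 2) \<or>
    (p 2 \<longrightarrow> p 1) \<and> (p 1 \<longrightarrow> p 3) \<or> (p 1 \<longrightarrow> p 2) \<and> (p 2 \<longrightarrow> p 3)"
    by blast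
  then show ?thesis
    using ex[of 1 2 3] ex[of 1 3 2] ex[of 2 1 3] ex[of 2 3 1] ex[of 3 1 2] ex[of 3 2 1]
    by (simp add: insert_commute) blast
qed

lemma entry_Triple: "entry (Triple (f A) (f B) (f C)) q = f q"
  by (cases q) simp_all

lemma ex_realizes:
  assumes a: "a \<in> automata" and e: "bij_betw e UNIV {1, 2, 3}"
  shows "\<exists>t. realizes a e t \<and> (\<forall>q. active (entry t q) \<longleftrightarrow> a (e q) 1 = 1)"
proof -
  let ?r = "\<lambda>q. Row (a (e q) 1 = 1) (inv_into UNIV e (a (e q) 2)) (inv_into UNIV e (a (e q) 3))"
  let ?t = "Triple (?r A) (?r B) (?r C)"
  have row: "entry ?t q = ?r q" for q
    by (rule entry_Triple[of ?r])
  have range: "range e = {1, 2, 3}" using e by (rule bij_betw_imp_surj_on)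
  have "realizes a e ?t"
    unfolding realizes_def
  proof (intro conjI allI)
    fix q
    have q: "e q \<in> {1, 2, 3}" using range by blast
    note entries = automata_entries[OF a q]
    show "a (e q) 1 = of_bool (active (entry ?t q))"
      using entries(1) unfolding row by auto
    show "a (e q) 2 = e (target (entry ?t q) False)" "a (e q) 3 = e (target (entry ?t q) True)"
      using entries(2,3) unfolding row target.simps by (simp_all only: f_inv_into_f range)
  qed (rule e)
  moreover have "active (entry ?t q) \<longleftrightarrow> a (e q) 1 = 1" for q
    unfolding row by (rule active.simps)
  ultimately show ?thesis by blast
qed

section \<open>Exhaustive check of the mixed tables\<close>

definition rows :: "bool \<Rightarrow> row list" where
  "rows f = [Row f x y. x \<leftarrow> states, y \<leftarrow> states]"

lemma Row_in_rows: "Row f x y \<in> set (rows f)"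
  by (auto simp: rows_def set_states)

text \<open>The check is split by the activity of the second state and the first target of the first
  one, which gives six evaluations of 243 tables each.\<close>

lemma classified_inactive_A:
  "every (\<lambda>y. every (\<lambda>r2. every (\<lambda>r3. classified (Triple (Row True A y) r2 r3))
     (rows False)) (rows False)) states"
  by code_simp

lemma classified_inactive_B:
  "every (\<lambda>y. every (\<lambda>r2. every (\<lambda>r3. classified (Triple (Row True B y) r2 r3))
     (rows False)) (rows False)) states"
  by code_simp

lemma classified_inactive_C:
  "every (\<lambda>y. every (\<lambda>r2. every (\<lambda>r3. classified (Triple (Row True C y) r2 r3))
     (rows False)) (rows False)) states"
  by code_simp

lemma classified_active_A:
  "every (\<lambda>y. every (\<lambda>r2. every (\<lambda>r3. classified (Triple (Row True A y) r2 r3))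
     (rows False)) (rows True)) states"
  by code_simp

lemma classified_active_B:
  "every (\<lambda>y. every (\<lambda>r2. every (\<lambda>r3. classified (Triple (Row True B y) r2 r3))
     (rows False)) (rows True)) states"
  by code_simp

lemma classified_active_C:
  "every (\<lambda>y. every (\<lambda>r2. every (\<lambda>r3. classified (Triple (Row True C y) r2 r3))
     (rows False)) (rows True)) states"
  by code_simp

lemma classified_row:
  "classified (Triple (Row True x y) (Row f u v) (Row False u' v'))"
proof -
  have "every (\<lambda>y. every (\<lambda>r2. every (\<lambda>r3. classified (Triple (Row True x y) r2 r3))
     (rows False)) (rows f)) states"
    by (cases x; cases f) (simp_all only: classified_inactive_A classified_inactive_B
      classified_inactive_C classified_active_A classified_active_B classified_active_C)
  then show ?thesis
    by (simp only: every_iff set_states Row_in_rows UNIV_I)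
qed

text \<open>After sorting, no state is active, all are, or the first is and the last is not. Only
  the last case relies on certificates.\<close>

lemma automaton_group_classification:
  assumes a: "a \<in> automata" and fin: "finite (carrier (automaton_group a))"
  shows "automaton_group a \<cong> singleton_group () \<or>
    (\<exists>(n, k)\<in>finite_types. automaton_group a \<cong> dihedral_group n \<times>\<times> integer_mod_group k)"
proof -
  obtain e where e: "bij_betw e UNIV {1, 2, 3}"
    and sorted: "a (e C) 1 = 1 \<longrightarrow> a (e B) 1 = 1" "a (e B) 1 = 1 \<longrightarrow> a (e A) 1 = 1"
    using ex_sorted_states[of "\<lambda>q. a q 1 = 1"] by blast
  obtain t where t: "realizes a e t" and act: "\<And>q. active (entry t q) \<longleftrightarrow> a (e q) 1 = 1"
    using ex_realizes[OF a e] by blast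
  have iso: "automaton_group a \<cong> word_group t"
    by (rule automaton_group_iso_word_group[OF t])
  have "finite (range (act t))"
    using fin iso unfolding is_iso_def iso_def
    by (auto dest: bij_betw_finite)
  \<comment> \<open>Finiteness excludes the first alternative of
    \<open>classified_imp\<close>.\<close>
  then have cl: ?thesis if "classified t"
    using classified_imp[OF that] iso_trans[OF iso] by blast
  obtain f x y g u v h u' v' where T: "t = Triple (Row f x y) (Row g u v) (Row h u' v')"
    by (metis active.cases triple.exhaust)
  have s: "h \<longrightarrow> g" "g \<longrightarrow> f"
    using sorted act[of A] act[of B] act[of C] by (simp_all add: T)
  have all: "(\<forall>q. active (entry t q) = b) \<longleftrightarrow> f = b \<and> g = b \<and> h = b" for b
    unfolding T using entry.simps active.simps by (metis state.exhaust)
  consider "\<not> f" "\<not> g" "\<not> h" | f g h | f "\<not> h"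
    using s by blast
  then show ?thesis
  proof cases
    case 1
    then show ?thesis
      using all[of False] inactive_iso_trivial iso_trans[OF iso] by blast
  next
    case 2
    then have "word_group t \<cong> dihedral_group 1 \<times>\<times> integer_mod_group 1"
      using all[of True] by (intro active_iso_cyclic) blast
    then show ?thesis
      using iso_trans[OF iso] by (auto simp: finite_types_def)
  next
    case 3
    then show ?thesis using cl classified_row by (simp add: T)
  qed
qed

section \<open>The six representatives\<close>

definition state_number :: "state \<Rightarrow> nat" where
  "state_number q = (case q of A \<Rightarrow> 1 | B \<Rightarrow> 2 | C \<Rightarrow> 3)"

text \<open>The automaton of a table with its states numbered in order; the restrictions place it in
  the extensional set \<open>automata\<close>.\<close>

definition table_automaton :: "table \<Rightarrow> nat \<Rightarrow> nat \<Rightarrow> nat" where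
  "table_automaton t = (\<lambda>q\<in>{1, 2, 3}. \<lambda>j\<in>{1, 2, 3}.
     let r = entry t (if q = 1 then A else if q = 2 then B else C)
     in if j = 1 then of_bool (active r) else state_number (target r (j = 3)))"

lemma state_number_in: "state_number q \<in> {1, 2, 3}"
  by (cases q) (simp_all add: state_number_def)

lemma table_automaton_in_automata: "table_automaton t \<in> automata"
  unfolding table_automaton_def automata_def restrict_PiE_iff
  using state_number_in by (auto simp: Let_def)

lemma realizes_table_automaton: "realizes (table_automaton t) state_number t"
proof -
  have "inj state_number"
    by (rule injI) (auto simp: state_number_def split: state.splits)
  moreover have "range state_number = state_number ` set states"
    by (simp only: set_states)
  then have "range state_number = {1, 2, 3}"
    by (simp add: states_def state_number_def)
  ultimately have "bij_betw state_number UNIV {1, 2, 3}"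
    by (simp add: bij_betw_def)
  moreover have "(if state_number q = 1 then A else if state_number q = 2 then B else C) = q" for q
    by (cases q) (simp_all add: state_number_def)
  ultimately show ?thesis
    using state_number_in
    by (simp add: realizes_def table_automaton_def Let_def del: One_nat_def)
qed

text \<open>By injectivity of the numbering, an automaton is identified by computing its
  number.\<close>

lemma \<A>_iso_word_group:
  assumes "automaton_number (table_automaton t) = n" "1 \<le> n" "n \<le> 5832"
  shows "automaton_group (\<A> n) \<cong> word_group t"
proof -
  have "\<A> n = table_automaton t"
    using automaton_number_inj \<A>_properties[OF assms(2,3)] table_automaton_in_automata assms(1)
    by metis
  then show ?thesis
    using automaton_group_iso_word_group[OF realizes_table_automaton] by metis
qed

lemmas table_automaton_number_simps =
  automaton_number_def table_automaton_def state_number_def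

lemma dihedral_1_times_1: "dihedral_group 1 \<times>\<times> integer_mod_group 1 \<cong> integer_mod_group 2"
proof (rule is_isoI, rule isoI)
  let ?f = "\<lambda>((i::int, j), l::int). int j"
  show "?f \<in> hom (dihedral_group 1 \<times>\<times> integer_mod_group 1) (integer_mod_group 2)"
    by (rule homI) (auto simp: dihedral_group_def carrier_integer_mod_group zmod_int)
  show "bij_betw ?f (carrier (dihedral_group 1 \<times>\<times> integer_mod_group 1)) (carrier (integer_mod_group 2))"
    by (rule bij_betw_byWitness[of _ "\<lambda>j. ((0, nat j), 0)"])
      (auto simp: dihedral_group_def carrier_integer_mod_group)
qed

lemma dihedral_1_times_2:
  "dihedral_group 1 \<times>\<times> integer_mod_group 2 \<cong> integer_mod_group 2 \<times>\<times> integer_mod_group 2"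
proof (rule is_isoI, rule isoI)
  let ?f = "\<lambda>((i::int, j), l::int). (int j, l)"
  show "?f \<in> hom (dihedral_group 1 \<times>\<times> integer_mod_group 2) (integer_mod_group 2 \<times>\<times> integer_mod_group 2)"
    by (rule homI) (auto simp: dihedral_group_def carrier_integer_mod_group zmod_int)
  show "bij_betw ?f (carrier (dihedral_group 1 \<times>\<times> integer_mod_group 2))
      (carrier (integer_mod_group 2 \<times>\<times> integer_mod_group 2))"
    by (rule bij_betw_byWitness[of _ "\<lambda>(j, l). ((0, nat j), l)"])
      (auto simp: dihedral_group_def carrier_integer_mod_group)
qed

lemma dihedral_2_times_2:
  "dihedral_group 2 \<times>\<times> integer_mod_group 2 \<cong>
     integer_mod_group 2 \<times>\<times> integer_mod_group 2 \<times>\<times> integer_mod_group 2"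
proof (rule is_isoI, rule isoI)
  let ?f = "\<lambda>((i::int, j), l::int). (i, int j, l)"
  \<comment> \<open>Inversion is trivial modulo 2, so the semidirect product is direct.\<close>
  have sign: "(i + (- 1) ^ j * k) mod 2 = (i + k) mod 2" for i k :: int and j :: nat
    by (cases "even j") (simp_all, presburger)
  show "?f \<in> hom (dihedral_group 2 \<times>\<times> integer_mod_group 2)
      (integer_mod_group 2 \<times>\<times> integer_mod_group 2 \<times>\<times> integer_mod_group 2)"
    by (rule homI) (auto simp: dihedral_group_def carrier_integer_mod_group zmod_int sign)
  show "bij_betw ?f (carrier (dihedral_group 2 \<times>\<times> integer_mod_group 2))
      (carrier (integer_mod_group 2 \<times>\<times> integer_mod_group 2 \<times>\<times> integer_mod_group 2))"
    by (rule bij_betw_byWitness[of _ "\<lambda>(i, j, l). ((i, nat j), l)"])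
      (auto simp: dihedral_group_def carrier_integer_mod_group)
qed

lemma dihedral_4_times_1: "dihedral_group 4 \<times>\<times> integer_mod_group 1 \<cong> dihedral_group 4"
proof (rule is_isoI, rule isoI)
  show "fst \<in> hom (dihedral_group 4 \<times>\<times> integer_mod_group 1) (dihedral_group 4)"
    by (rule homI) auto
  show "bij_betw fst (carrier (dihedral_group 4 \<times>\<times> integer_mod_group 1)) (carrier (dihedral_group 4))"
    by (rule bij_betw_byWitness[of _ "\<lambda>x. (x, 0)"]) (auto simp: carrier_integer_mod_group)
qed

lemma automaton_group_\<A>_1: "automaton_group (\<A> 1) \<cong> singleton_group ()"
proof -
  let ?t = "Triple (Row False A A) (Row False A A) (Row False A A)"
  have "\<not> active (entry ?t q)" for q by (cases q) simp_all
  then have "word_group ?t \<cong> singleton_group ()" by (rule inactive_iso_trivial)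
  then show ?thesis
    by (intro iso_trans[OF \<A>_iso_word_group[of ?t]]) (simp_all add: table_automaton_number_simps)
qed

text \<open>Here \<open>B\<close> and \<open>C\<close> act trivially, and \<open>A\<close>
  complements every entry.\<close>

lemma automaton_group_\<A>_1090: "automaton_group (\<A> 1090) \<cong> dihedral_group 1 \<times>\<times> integer_mod_group 1"
proof -
  let ?t = "Triple (Row True A A) (Row False B B) (Row False B B)"
  have "finite_certificate ?t (1, 1, [], [P A], [], Triple (0, 1, 0) (0, 0, 0) (0, 0, 0))"
    by code_simp
  then have "word_group ?t \<cong> dihedral_group 1 \<times>\<times> integer_mod_group 1"
    by (rule finite_certificate_iso) simp_all
  then show ?thesis
    by (intro iso_trans[OF \<A>_iso_word_group[of ?t]]) (simp_all add: table_automaton_number_simps)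
qed

text \<open>\<open>A\<close> complements all entries and \<open>B = C\<close> all but the
  first.\<close>

lemma automaton_group_\<A>_730: "automaton_group (\<A> 730) \<cong> dihedral_group 1 \<times>\<times> integer_mod_group 2"
proof -
  let ?t = "Triple (Row True A A) (Row False A A) (Row False A A)"
  have "finite_certificate ?t (1, 2, [], [P B], [P A], Triple (0, 0, 1) (0, 1, 0) (0, 1, 0))"
    by code_simp
  then have "word_group ?t \<cong> dihedral_group 1 \<times>\<times> integer_mod_group 2"
    by (rule finite_certificate_iso) simp_all
  then show ?thesis
    by (intro iso_trans[OF \<A>_iso_word_group[of ?t]]) (simp_all add: table_automaton_number_simps)
qed

text \<open>\<open>B\<close> is trivial and \<open>C\<close> acts as \<open>A\<close> below the
  vertex 1 only; the product of the involutions \<open>A\<close> and \<open>C\<close> has order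
  4.\<close>

lemma automaton_group_\<A>_847: "automaton_group (\<A> 847) \<cong> dihedral_group 4 \<times>\<times> integer_mod_group 1"
proof -
  let ?t = "Triple (Row True A A) (Row False B B) (Row False B A)"
  have "finite_certificate ?t (4, 1, [P A, P C], [P A], [], Triple (0, 1, 0) (0, 0, 0) (1, 1, 0))"
    by code_simp
  then have "word_group ?t \<cong> dihedral_group 4 \<times>\<times> integer_mod_group 1"
    by (rule finite_certificate_iso) simp_all
  then show ?thesis
    by (intro iso_trans[OF \<A>_iso_word_group[of ?t]]) (simp_all add: table_automaton_number_simps)
qed

text \<open>\<open>A\<close>, \<open>C\<close> and \<open>B\<close> complement all entries except
  the first 0, 1 and 2 respectively: three independent commuting involutions.\<close>

lemma automaton_group_\<A>_802: "automaton_group (\<A> 802) \<cong> dihedral_group 2 \<times>\<times> integer_mod_group 2"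
proof -
  let ?t = "Triple (Row True A A) (Row False C C) (Row False A A)"
  have "finite_certificate ?t (2, 2, [P A], [P B], [P C], Triple (1, 0, 0) (0, 1, 0) (0, 0, 1))"
    by code_simp
  then have "word_group ?t \<cong> dihedral_group 2 \<times>\<times> integer_mod_group 2"
    by (rule finite_certificate_iso) simp_all
  then show ?thesis
    by (intro iso_trans[OF \<A>_iso_word_group[of ?t]]) (simp_all add: table_automaton_number_simps)
qed

text \<open>The involutions \<open>A\<close> and \<open>B\<close> have a product of order 4, and
  \<open>C\<close>, which complements all entries but the first, commutes with both.\<close>

lemma automaton_group_\<A>_748: "automaton_group (\<A> 748) \<cong> dihedral_group 4 \<times>\<times> integer_mod_group 2"
proof -
  let ?t = "Triple (Row True A A) (Row False C A) (Row False A A)"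
  have "finite_certificate ?t (4, 2, [P B, P A], [P B], [P C], Triple (1, 1, 0) (0, 1, 0) (0, 0, 1))"
    by code_simp
  then have "word_group ?t \<cong> dihedral_group 4 \<times>\<times> integer_mod_group 2"
    by (rule finite_certificate_iso) simp_all
  then show ?thesis
    by (intro iso_trans[OF \<A>_iso_word_group[of ?t]]) (simp_all add: table_automaton_number_simps)
qed

section \<open>Counting isomorphism classes\<close>

lemma group_automaton_group: "group (automaton_group a)"
  unfolding automaton_group_def by (rule group.group_subgroup_generated[OF group_tree_aut])

text \<open>The rotation \<open>(1, 0)\<close> and the reflection \<open>(0, 1)\<close> do not
  commute, whereas the other group is abelian.\<close>

lemma dihedral_4_not_iso_elementary_abelian:
  "\<not> dihedral_group 4 \<cong> integer_mod_group 2 \<times>\<times> integer_mod_group 2 \<times>\<times> integer_mod_group 2"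
proof
  let ?D = "dihedral_group 4" and ?E = "integer_mod_group 2 \<times>\<times> integer_mod_group 2 \<times>\<times> integer_mod_group 2"
  assume "?D \<cong> ?E"
  then obtain h where "h \<in> iso ?D ?E" unfolding is_iso_def by blast
  then have h: "h \<in> hom ?D ?E" "inj_on h (carrier ?D)"
    by (auto simp: iso_def bij_betw_def)
  have x: "(1, 0) \<in> carrier ?D" and y: "(0, 1) \<in> carrier ?D"
    by (simp_all add: dihedral_group_def)
  have "u \<otimes>\<^bsub>?E\<^esub> v = v \<otimes>\<^bsub>?E\<^esub> u" for u v
    by (cases u; cases v) (simp add: add.commute)
  then have "h ((1, 0) \<otimes>\<^bsub>?D\<^esub> (0, 1)) = h ((0, 1) \<otimes>\<^bsub>?D\<^esub> (1, 0))"
    using hom_mult[OF h(1) x y] hom_mult[OF h(1) y x] by simp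
  moreover have "(1, 0) \<otimes>\<^bsub>?D\<^esub> (0, 1) \<in> carrier ?D" "(0, 1) \<otimes>\<^bsub>?D\<^esub> (1, 0) \<in> carrier ?D"
    by (simp_all add: dihedral_group_def)
  ultimately have "(1, 0) \<otimes>\<^bsub>?D\<^esub> (0, 1) = (0, 1) \<otimes>\<^bsub>?D\<^esub> (1, 0)"
    using h(2) by (auto dest: inj_onD)
  then show False by (simp add: dihedral_group_def)
qed

theorem theorem2:
  shows "card ({a \<in> automata. finite (carrier (automaton_group a))} //
               {(a, b). a \<in> automata \<and> b \<in> automata \<and>
                        finite (carrier (automaton_group a)) \<and>
                        finite (carrier (automaton_group b)) \<and>
                        automaton_group a \<cong> automaton_group b}) = 6 \<and>
         (\<forall>a\<in>automata. finite (carrier (automaton_group a)) \<longrightarrow>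
           (\<exists>n\<in>{1, 1090, 730, 847, 802, 748}. automaton_group a \<cong> automaton_group (\<A> n))) \<and>
         automaton_group (\<A> 1) \<cong> singleton_group () \<and>
         automaton_group (\<A> 1090) \<cong> integer_mod_group 2 \<and>
         automaton_group (\<A> 730) \<cong> integer_mod_group 2 \<times>\<times> integer_mod_group 2 \<and>
         automaton_group (\<A> 847) \<cong> dihedral_group 4 \<and>
         automaton_group (\<A> 802) \<cong>
           integer_mod_group 2 \<times>\<times> integer_mod_group 2 \<times>\<times> integer_mod_group 2 \<and>
         automaton_group (\<A> 748) \<cong> dihedral_group 4 \<times>\<times> integer_mod_group 2"
proof -
  let ?g = "\<lambda>n. automaton_group (\<A> n)"
  let ?N = "{1, 1090, 730, 847, 802, 748} :: nat set"
  define S where "S = {a \<in> automata. finite (carrier (automaton_group a))}"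
  define R where "R = {(a, b). a \<in> automata \<and> b \<in> automata \<and>
    finite (carrier (automaton_group a)) \<and> finite (carrier (automaton_group b)) \<and>
    automaton_group a \<cong> automaton_group b}"
  note sym = group.iso_sym[OF group_automaton_group]
  note iso1 = automaton_group_\<A>_1
  note iso1090 = iso_trans[OF automaton_group_\<A>_1090 dihedral_1_times_1]
  note iso730 = iso_trans[OF automaton_group_\<A>_730 dihedral_1_times_2]
  note iso847 = iso_trans[OF automaton_group_\<A>_847 dihedral_4_times_1]
  note iso802 = iso_trans[OF automaton_group_\<A>_802 dihedral_2_times_2]
  note iso748 = automaton_group_\<A>_748
  have representative: "\<exists>n\<in>?N. automaton_group a \<cong> ?g n" if a: "a \<in> S" for a
  proof -
    consider "automaton_group a \<cong> singleton_group ()"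
      | n k where "(n, k) \<in> finite_types"
        "automaton_group a \<cong> dihedral_group n \<times>\<times> integer_mod_group k"
      using automaton_group_classification[of a] a unfolding S_def by blast
    then show ?thesis
    proof cases
      case 1
      then show ?thesis using iso_trans[OF _ sym[OF iso1]] by blast
    next
      case 2
      then consider "n = 1" "k = 1" | "n = 1" "k = 2" | "n = 2" "k = 2" | "n = 4" "k = 1" | "n = 4" "k = 2"
        unfolding finite_types_def by blast
      then show ?thesis
      proof cases
        case 1
        then show ?thesis using iso_trans[OF _ sym[OF automaton_group_\<A>_1090]] 2(2) by blast
      next
        case 2
        then show ?thesis
          using iso_trans[OF _ sym[OF automaton_group_\<A>_730]] \<open>automaton_group a \<cong> _\<close> by blast
      next
        case 3
        then show ?thesis
          using iso_trans[OF _ sym[OF automaton_group_\<A>_802]] \<open>automaton_group a \<cong> _\<close> by blast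
      next
        case 4
        then show ?thesis
          using iso_trans[OF _ sym[OF automaton_group_\<A>_847]] \<open>automaton_group a \<cong> _\<close> by blast
      next
        case 5
        then show ?thesis
          using iso_trans[OF _ sym[OF automaton_group_\<A>_748]] \<open>automaton_group a \<cong> _\<close> by blast
      qed
    qed
  qed
  \<comment> \<open>The orders separate all six groups except the two of order 8.\<close>
  have cards: "card (carrier (?g 1)) = 1" "card (carrier (?g 1090)) = 2" "card (carrier (?g 730)) = 4"
    "card (carrier (?g 847)) = 8" "card (carrier (?g 802)) = 8" "card (carrier (?g 748)) = 16"
    unfolding iso_same_card[OF iso1] iso_same_card[OF iso1090] iso_same_card[OF iso730]
      iso_same_card[OF iso847] iso_same_card[OF iso802] iso_same_card[OF iso748]
    by (simp_all add: singleton_group_def dihedral_group_def carrier_integer_mod_group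
        card_cartesian_product)
  have S: "\<A> n \<in> S" if "n \<in> ?N" for n
  proof -
    have "1 \<le> n" "n \<le> 5832" using that by auto
    then have "\<A> n \<in> automata" by (rule \<A>_properties)
    \<comment> \<open>An infinite set has \<open>card\<close> 0, so a positive value proves
      finiteness.\<close>
    moreover have "card (carrier (?g n)) > 0" using that cards by auto
    then have "finite (carrier (?g n))" by (rule card_ge_0_finite)
    ultimately show ?thesis by (simp add: S_def)
  qed
  have "\<not> ?g 847 \<cong> ?g 802"
    using dihedral_4_not_iso_elementary_abelian iso_trans[OF sym[OF iso847]] iso_trans[OF _ iso802]
    by blast
  then have "\<not> ?g 802 \<cong> ?g 847"
    using sym by blast
  then have distinct: "m = n" if "m \<in> ?N" "n \<in> ?N" "?g m \<cong> ?g n" for m n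
    using that iso_same_card[OF that(3)] cards \<open>\<not> ?g 847 \<cong> ?g 802\<close>
    by (elim insertE emptyE) simp_all
  have R: "equiv S R"
  proof (rule equivI)
    show "R \<subseteq> S \<times> S" unfolding R_def S_def by blast
    show "refl_on S R" unfolding refl_on_def R_def S_def by (auto intro: iso_refl)
    show "Relation.sym R" unfolding sym_on_def R_def using sym by blast
    show "trans R" unfolding trans_on_def R_def using iso_trans by blast
  qed
  have in_R: "(a, b) \<in> R \<longleftrightarrow> a \<in> S \<and> b \<in> S \<and> automaton_group a \<cong> automaton_group b" for a b
    unfolding R_def S_def by blast
  \<comment> \<open>Sending a number to the class of its automaton is onto by
    \<open>representative\<close> and, below, injective by \<open>distinct\<close>.\<close>
  have "S // R = (\<lambda>n. R `` {\<A> n}) ` ?N"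
  proof
    show "S // R \<subseteq> (\<lambda>n. R `` {\<A> n}) ` ?N"
    proof
      fix Y assume "Y \<in> S // R"
      then obtain a where a: "a \<in> S" "Y = R `` {a}" by (rule quotientE)
      then obtain n where "n \<in> ?N" "automaton_group a \<cong> ?g n" using representative by blast
      then have "(a, \<A> n) \<in> R" using a S in_R by blast
      then have "Y = R `` {\<A> n}" using a(2) equiv_class_eq[OF R] by blast
      then show "Y \<in> (\<lambda>n. R `` {\<A> n}) ` ?N" using \<open>n \<in> ?N\<close> by blast
    qed
    show "(\<lambda>n. R `` {\<A> n}) ` ?N \<subseteq> S // R"
      using S by (blast intro: quotientI)
  qed
  moreover have "inj_on (\<lambda>n. R `` {\<A> n}) ?N"
  proof (rule inj_onI)
    fix m n assume "m \<in> ?N" "n \<in> ?N" "R `` {\<A> m} = R `` {\<A> n}"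
    then show "m = n"
      using eq_equiv_class[OF _ R S] in_R distinct by blast
  qed
  ultimately have "card (S // R) = card ?N" using card_image by metis
  then have "card (S // R) = 6" by simp
  then show ?thesis
    using representative iso1 iso1090 iso730 iso847 iso802 iso748
    unfolding S_def R_def by blast
qed

end
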